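(* (In $\mathsf{ZF}$.) Every C-finite set is H-finite.
   Context: Work in $\mathsf{ZF}$, without the Axiom of Choice. A set is finite if it is in bijection with some $n\in\omega$, and infinite otherwise. A set $X$ is C-finite if there is no surjection $f:X\to\omega$. $[X]^{<\omega}$ is the set of all finite subsets of $X$, a group under symmetric difference $\bigtriangleup$. For $Y\subseteq[X]^{<\omega}$, $\mathrm{FS}(Y)=\{\sum_{y\in F}y : F\subseteq Y\text{ finite nonempty}\}$, with sums computed with respect to $\bigtriangleup$. A set $X$ is H-finite if there is a colouring $c:[X]^{<\omega}\to 2=\{0,1\}$ such that for every infinite $Y\subseteq[X]^{<\omega}$ the colouring $c$ is not constant on $\mathrm{FS}(Y)$. *)

theory Defs
  imports Main
begin

text \<open>
  HOL satisfies the Axiom of Choice, so a theorem of choice-free ZF cannot be stated faithfully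
  about HOL's own sets. It is stated instead about an arbitrary model of first-order ZF: a
  type with a binary relation, where Separation and Replacement are restricted to first-order
  formulas with parameters. (With arbitrary HOL predicates in the schemas, every model would
  inherit the Axiom of Choice from HOL.) By the completeness and Loewenheim--Skolem theorems,
  truth in all such models, over all types, is provability in ZF.
\<close>

datatype fm =
    Mem nat nat
  | Eq nat nat
  | Neg fm
  | Conj fm fm
  | All nat fm

locale set_structure =
  fixes mem :: "'a \<Rightarrow> 'a \<Rightarrow> bool"  (infix "\<^bold>\<in>" 50)
begin

primrec sat :: "(nat \<Rightarrow> 'a) \<Rightarrow> fm \<Rightarrow> bool" where
  "sat \<rho> (Mem i j) \<longleftrightarrow> \<rho> i \<^bold>\<in> \<rho> j"
| "sat \<rho> (Eq i j) \<longleftrightarrow> \<rho> i = \<rho> j"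
| "sat \<rho> (Neg \<phi>) \<longleftrightarrow> \<not> sat \<rho> \<phi>"
| "sat \<rho> (Conj \<phi> \<psi>) \<longleftrightarrow> sat \<rho> \<phi> \<and> sat \<rho> \<psi>"
| "sat \<rho> (All i \<phi>) \<longleftrightarrow> (\<forall>x. sat (\<rho>(i := x)) \<phi>)"

text \<open>
  Each notion below is written with quantifiers over the model only, i.e. it is the
  interpretation in the model of a first-order formula in the membership relation. Set-theoretic
  operations are given as relations whose last argument is the value.
\<close>

definition subset :: "'a \<Rightarrow> 'a \<Rightarrow> bool"  (infix "\<^bold>\<subseteq>" 50) where
  "x \<^bold>\<subseteq> y \<longleftrightarrow> (\<forall>z. z \<^bold>\<in> x \<longrightarrow> z \<^bold>\<in> y)"

definition is_empty :: "'a \<Rightarrow> bool" where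
  "is_empty z \<longleftrightarrow> (\<forall>x. \<not> x \<^bold>\<in> z)"

definition is_succ :: "'a \<Rightarrow> 'a \<Rightarrow> bool" where
  "is_succ x y \<longleftrightarrow> (\<forall>z. z \<^bold>\<in> y \<longleftrightarrow> z \<^bold>\<in> x \<or> z = x)"

definition is_inductive :: "'a \<Rightarrow> bool" where
  "is_inductive v \<longleftrightarrow>
     (\<exists>z. is_empty z \<and> z \<^bold>\<in> v) \<and> (\<forall>x. x \<^bold>\<in> v \<longrightarrow> (\<exists>y. is_succ x y \<and> y \<^bold>\<in> v))"

definition is_omega :: "'a \<Rightarrow> bool" where
  "is_omega w \<longleftrightarrow> is_inductive w \<and> (\<forall>v. is_inductive v \<longrightarrow> w \<^bold>\<subseteq> v)"

definition is_two :: "'a \<Rightarrow> bool" where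
  "is_two t \<longleftrightarrow> (\<exists>z u. is_empty z \<and> is_succ z u \<and> is_succ u t)"

definition is_upair :: "'a \<Rightarrow> 'a \<Rightarrow> 'a \<Rightarrow> bool" where
  "is_upair x y p \<longleftrightarrow> (\<forall>z. z \<^bold>\<in> p \<longleftrightarrow> z = x \<or> z = y)"

definition is_opair :: "'a \<Rightarrow> 'a \<Rightarrow> 'a \<Rightarrow> bool" where
  "is_opair x y p \<longleftrightarrow> (\<exists>u v. is_upair x x u \<and> is_upair x y v \<and> is_upair u v p)"

definition maps_to :: "'a \<Rightarrow> 'a \<Rightarrow> 'a \<Rightarrow> bool" where
  "maps_to f x y \<longleftrightarrow> (\<exists>p. is_opair x y p \<and> p \<^bold>\<in> f)"

definition is_function :: "'a \<Rightarrow> 'a \<Rightarrow> 'a \<Rightarrow> bool" where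
  "is_function f A B \<longleftrightarrow>
     (\<forall>p. p \<^bold>\<in> f \<longrightarrow> (\<exists>x y. x \<^bold>\<in> A \<and> y \<^bold>\<in> B \<and> is_opair x y p)) \<and>
     (\<forall>x. x \<^bold>\<in> A \<longrightarrow> (\<exists>!y. maps_to f x y))"

definition is_surjection :: "'a \<Rightarrow> 'a \<Rightarrow> 'a \<Rightarrow> bool" where
  "is_surjection f A B \<longleftrightarrow>
     is_function f A B \<and> (\<forall>y. y \<^bold>\<in> B \<longrightarrow> (\<exists>x. x \<^bold>\<in> A \<and> maps_to f x y))"

definition is_bijection :: "'a \<Rightarrow> 'a \<Rightarrow> 'a \<Rightarrow> bool" where
  "is_bijection f A B \<longleftrightarrow>
     is_surjection f A B \<and> (\<forall>x x' y. maps_to f x y \<and> maps_to f x' y \<longrightarrow> x = x')"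

definition Finite :: "'a \<Rightarrow> bool" where
  "Finite x \<longleftrightarrow> (\<exists>w n f. is_omega w \<and> n \<^bold>\<in> w \<and> is_bijection f x n)"

definition C_finite :: "'a \<Rightarrow> bool" where
  "C_finite X \<longleftrightarrow> \<not> (\<exists>w f. is_omega w \<and> is_surjection f X w)"

definition is_finite_subsets :: "'a \<Rightarrow> 'a \<Rightarrow> bool" where
  "is_finite_subsets X G \<longleftrightarrow> (\<forall>s. s \<^bold>\<in> G \<longleftrightarrow> s \<^bold>\<subseteq> X \<and> Finite s)"

definition is_symdiff :: "'a \<Rightarrow> 'a \<Rightarrow> 'a \<Rightarrow> bool" where
  "is_symdiff x y d \<longleftrightarrow> (\<forall>z. z \<^bold>\<in> d \<longleftrightarrow> \<not> (z \<^bold>\<in> x \<longleftrightarrow> z \<^bold>\<in> y))"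

text \<open>
  \<open>is_sum G F t\<close> says that \<open>t\<close> is the sum of the finite set \<open>F\<close> in the group \<open>G\<close>: for some
  enumeration \<open>e\<close> of \<open>F\<close> by \<open>n \<in> \<omega>\<close>, the partial sums \<open>s(0) = \<emptyset>\<close>, \<open>s(k + 1) = s(k) \<triangle> e(k)\<close> end in
  \<open>s(n) = t\<close>. In the clause for \<open>s(0)\<close>, the empty set is both the ordinal 0 and the neutral element.
\<close>

definition is_sum :: "'a \<Rightarrow> 'a \<Rightarrow> 'a \<Rightarrow> bool" where
  "is_sum G F t \<longleftrightarrow> (\<exists>w n m e s.
     is_omega w \<and> n \<^bold>\<in> w \<and> is_succ n m \<and> is_bijection e n F \<and> is_function s m G \<and>
     (\<exists>z. is_empty z \<and> maps_to s z z) \<and>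
     (\<forall>k. k \<^bold>\<in> n \<longrightarrow> (\<exists>k' y a b. is_succ k k' \<and> maps_to e k y \<and>
        maps_to s k a \<and> maps_to s k' b \<and> is_symdiff a y b)) \<and>
     maps_to s n t)"

definition is_FS :: "'a \<Rightarrow> 'a \<Rightarrow> 'a \<Rightarrow> bool" where
  "is_FS G Y S \<longleftrightarrow>
     (\<forall>t. t \<^bold>\<in> S \<longleftrightarrow> (\<exists>F. F \<^bold>\<subseteq> Y \<and> Finite F \<and> \<not> is_empty F \<and> is_sum G F t))"

definition constant_on :: "'a \<Rightarrow> 'a \<Rightarrow> bool" where
  "constant_on c S \<longleftrightarrow> (\<exists>i. \<forall>t. t \<^bold>\<in> S \<longrightarrow> maps_to c t i)"

definition H_finite :: "'a \<Rightarrow> bool" where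
  "H_finite X \<longleftrightarrow> (\<exists>G T c. is_finite_subsets X G \<and> is_two T \<and> is_function c G T \<and>
     (\<forall>Y. Y \<^bold>\<subseteq> G \<and> \<not> Finite Y \<longrightarrow> (\<exists>S. is_FS G Y S \<and> \<not> constant_on c S)))"

end

text \<open>
  In the schemas, variable 0 (and variable 1 in Replacement) carries the schematic argument; the
  remaining values of \<open>\<rho>\<close> are the parameters.
\<close>

locale ZF_model = set_structure +
  assumes extensionality: "\<forall>x y. (\<forall>z. z \<^bold>\<in> x \<longleftrightarrow> z \<^bold>\<in> y) \<longrightarrow> x = y"
    and foundation: "\<forall>x. (\<exists>y. y \<^bold>\<in> x) \<longrightarrow> (\<exists>y. y \<^bold>\<in> x \<and> \<not> (\<exists>z. z \<^bold>\<in> x \<and> z \<^bold>\<in> y))"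
    and pairing: "\<forall>x y. \<exists>p. is_upair x y p"
    and union: "\<forall>x. \<exists>u. \<forall>z. z \<^bold>\<in> u \<longleftrightarrow> (\<exists>y. y \<^bold>\<in> x \<and> z \<^bold>\<in> y)"
    and power_set: "\<forall>x. \<exists>p. \<forall>z. z \<^bold>\<in> p \<longleftrightarrow> z \<^bold>\<subseteq> x"
    and infinity: "\<exists>v. is_inductive v"
    and separation:
      "\<forall>\<phi> \<rho> x. \<exists>y. \<forall>z. z \<^bold>\<in> y \<longleftrightarrow> z \<^bold>\<in> x \<and> sat (\<rho>(0 := z)) \<phi>"
    and replacement:
      "\<forall>\<phi> \<rho> x.
         (\<forall>u v v'. u \<^bold>\<in> x \<and> sat (\<rho>(0 := u, 1 := v)) \<phi> \<and> sat (\<rho>(0 := u, 1 := v')) \<phi> \<longrightarrow> v = v') \<longrightarrow>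
         (\<exists>y. \<forall>v. v \<^bold>\<in> y \<longleftrightarrow> (\<exists>u. u \<^bold>\<in> x \<and> sat (\<rho>(0 := u, 1 := v)) \<phi>))"

end

theory Submission
  imports Defs
begin

text \<open>
  Write \<open>|u|\<close> for the size of a finite set \<open>u\<close>, and choose \<open>grow n > n\<close> in \<open>\<omega>\<close> such that the union of
  two sets of size at most \<open>n\<close> has size at most \<open>grow n\<close>. The colour of \<open>u\<close> depends on \<open>|u|\<close> alone:
  \<open>Q\<close> is the set of numbers obtained from \<open>0\<close> by iterating \<open>grow \<circ> grow\<close>, and \<open>u\<close> is coloured \<open>1\<close>
  iff \<open>q < |u| \<le> grow q\<close> for some \<open>q \<in> Q\<close>. Hence both colours are missing from intervals
  \<open>(p, grow p]\<close> with \<open>p\<close> arbitrarily large: colour \<open>0\<close> is missing for \<open>p = q\<close>, and colour \<open>1\<close> for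
  \<open>p = grow q\<close> (lemma \<open>not_marked\<close>).

  Let \<open>Y\<close> be a set of finite subsets of \<open>X\<close> whose \<open>FS(Y)\<close> has a single colour. Then
  \<open>V = FS(Y) \<union> {\<emptyset>}\<close> is a group under symmetric difference (lemma \<open>FS_span\<close>), and for arbitrarily large
  \<open>p\<close> no element of \<open>V\<close> has its size in \<open>(p, grow p]\<close>. For such a \<open>p\<close> the elements of \<open>V\<close> of size
  at most \<open>p\<close> form a subgroup \<open>W\<close>, because a sum of two of them has size at most \<open>grow p\<close>.
  This \<open>W\<close> is finite: let \<open>v\<close> be an element of \<open>W\<close> of largest size. A nonempty \<open>u \<in> W\<close> disjoint
  from \<open>v\<close> would make \<open>v \<triangle> u\<close> larger than \<open>v\<close>, so the homomorphism \<open>u \<mapsto> u \<inter> v\<close> from \<open>W\<close> to the power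
  set of \<open>v\<close> is injective.

  C-finiteness of \<open>X\<close> selects the right \<open>p\<close>. Send a point \<open>x\<close> of \<open>\<Union>V\<close> to the least size of
  an element of \<open>V\<close> that contains \<open>x\<close>. A function from a C-finite set to \<open>\<omega>\<close> is bounded
  (lemma \<open>C_finite_bounded\<close>): an unbounded range could be enumerated in increasing order and would
  give a surjection onto \<open>\<omega>\<close>. If \<open>p\<close> is above this bound, then \<open>\<Union>V = \<Union>W\<close>, which is finite.
  So \<open>V\<close> is finite, and \<open>Y\<close> with it (lemma \<open>gap_imp_Finite\<close>).

  All of this is carried out inside a model, whose \<open>\<omega>\<close> may be nonstandard, so every induction,
  minimum and set-builder must be applied to a first-order definable property. Definability is
  therefore treated as a syntax-directed property of HOL predicates and functions, proved by
  introduction rules.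
\<close>

section \<open>Definable predicates and terms\<close>

primrec rename :: "(nat \<Rightarrow> nat) \<Rightarrow> fm \<Rightarrow> fm" where
  "rename f (Mem i j) = Mem (f i) (f j)"
| "rename f (Eq i j) = Eq (f i) (f j)"
| "rename f (Neg \<phi>) = Neg (rename f \<phi>)"
| "rename f (Conj \<phi> \<psi>) = Conj (rename f \<phi>) (rename f \<psi>)"
| "rename f (All i \<phi>) = All (f i) (rename f \<phi>)"

text \<open>
  An environment \<open>e\<close> of bound variables is stored at the even indices and the parameters \<open>\<sigma>\<close> at the
  odd ones, so that both supplies of variables are infinite.
\<close>

definition interleave :: "(nat \<Rightarrow> 'a) \<Rightarrow> (nat \<Rightarrow> 'a) \<Rightarrow> nat \<Rightarrow> 'a" where
  "interleave e \<sigma> i = (if even i then e (i div 2) else \<sigma> (i div 2))"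

lemma interleave_simps [simp]:
  "interleave e \<sigma> (2 * i) = e i" "interleave e \<sigma> (Suc (2 * i)) = \<sigma> i"
  by (auto simp: interleave_def)

lemma parity_split:
  fixes i :: nat
  obtains k where "i = 2 * k" | k where "i = Suc (2 * k)"
  by (metis evenE oddE Suc_eq_plus1)

context set_structure
begin

text \<open>
  Injectivity keeps a bound variable from capturing another one.
\<close>

lemma sat_rename: "inj f \<Longrightarrow> sat \<rho> (rename f \<phi>) \<longleftrightarrow> sat (\<lambda>i. \<rho> (f i)) \<phi>"
proof (induction \<phi> arbitrary: \<rho>)
  case (All i \<phi>)
  have "(\<lambda>j. (\<rho>(f i := x)) (f j)) = (\<lambda>j. \<rho> (f j))(i := x)" for x
    using All.prems by (auto simp: inj_eq)
  with All show ?case by simp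
qed auto

text \<open>
  Environments follow the de Bruijn convention: in a formula below a quantifier, \<open>e 0\<close> is the bound
  variable and \<open>\<lambda>i. e (Suc i)\<close> is the surrounding environment. The quantified \<open>\<sigma>\<close> allows arbitrary
  parameters from the model.
\<close>

definition definable :: "((nat \<Rightarrow> 'a) \<Rightarrow> bool) \<Rightarrow> bool" where
  "definable P \<longleftrightarrow> (\<exists>\<phi> \<sigma>. \<forall>e. P e \<longleftrightarrow> sat (interleave e \<sigma>) \<phi>)"

text \<open>
  A HOL-level operation counts as a term when its graph is definable. Such terms may then be used
  inside definable predicates (lemma \<open>definable_subst\<close>), although the formal language has no
  function symbols.
\<close>

definition definable_term :: "((nat \<Rightarrow> 'a) \<Rightarrow> 'a) \<Rightarrow> bool" where
  "definable_term t \<longleftrightarrow> definable (\<lambda>e. e 0 = t (\<lambda>i. e (Suc i)))"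

lemma definable_rename:
  assumes "definable P" "inj f"
  shows "definable (\<lambda>e. P (\<lambda>i. e (f i)))"
proof -
  obtain \<phi> \<sigma> where P: "\<And>e. P e \<longleftrightarrow> sat (interleave e \<sigma>) \<phi>"
    using assms(1) unfolding definable_def by blast
  let ?g = "\<lambda>i. if even i then 2 * f (i div 2) else i"
  have "inj ?g"
  proof (rule injI)
    show "i = j" if "?g i = ?g j" for i j
      using that assms(2) by (cases i rule: parity_split; cases j rule: parity_split)
          (auto simp: inj_eq, presburger+)
  qed
  moreover have "(\<lambda>i. interleave e \<sigma> (?g i)) = interleave (\<lambda>i. e (f i)) \<sigma>" for e
    by (auto simp: interleave_def)
  ultimately have "P (\<lambda>i. e (f i)) \<longleftrightarrow> sat (interleave e \<sigma>) (rename ?g \<phi>)" for e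
    using P by (simp add: sat_rename)
  then show ?thesis unfolding definable_def by blast
qed

lemma definable_not: "definable P \<Longrightarrow> definable (\<lambda>e. \<not> P e)"
  unfolding definable_def by (metis sat.simps(3))

text \<open>
  The two formulas have separate parameter lists. They are interleaved into one list, and the
  parameters in each formula are renamed to their new places.
\<close>

lemma definable_conj:
  assumes "definable P" "definable Q"
  shows "definable (\<lambda>e. P e \<and> Q e)"
proof -
  obtain \<phi> \<sigma> where P: "\<And>e. P e \<longleftrightarrow> sat (interleave e \<sigma>) \<phi>"
    using assms(1) unfolding definable_def by blast
  obtain \<psi> \<tau> where Q: "\<And>e. Q e \<longleftrightarrow> sat (interleave e \<tau>) \<psi>"
    using assms(2) unfolding definable_def by blast
  let ?f = "\<lambda>i. if even i then i else Suc (2 * (2 * (i div 2)))"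
  let ?g = "\<lambda>i. if even i then i else Suc (2 * (Suc (2 * (i div 2))))"
  have inj: "inj ?f" "inj ?g"
    by (rule injI; rename_tac i j; case_tac i rule: parity_split; case_tac j rule: parity_split;
        simp; presburger)+
  have "(\<lambda>i. interleave e (interleave \<sigma> \<tau>) (?f i)) = interleave e \<sigma>"
    "(\<lambda>i. interleave e (interleave \<sigma> \<tau>) (?g i)) = interleave e \<tau>" for e
    by (rule ext, rename_tac i, case_tac i rule: parity_split; simp add: interleave_def)+
  then have "P e \<and> Q e \<longleftrightarrow> sat (interleave e (interleave \<sigma> \<tau>)) (Conj (rename ?f \<phi>) (rename ?g \<psi>))" for e
    using P Q inj by (simp add: sat_rename)
  then show ?thesis unfolding definable_def by blast
qed

text \<open>
  The bound variable is moved to the first parameter place, index 1, and the parameters are shifted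
  up by one place to make room for it. This leaves the even indices to the surrounding environment.
\<close>

lemma definable_all:
  assumes "definable (\<lambda>e. P (e 0) (\<lambda>i. e (Suc i)))"
  shows "definable (\<lambda>e. \<forall>x. P x e)"
proof -
  obtain \<phi> \<sigma> where "\<And>e. P (e 0) (\<lambda>i. e (Suc i)) \<longleftrightarrow> sat (interleave e \<sigma>) \<phi>"
    using assms unfolding definable_def by blast
  from this[of "case_nat x e" for x e]
  have P: "P x e \<longleftrightarrow> sat (interleave (case_nat x e) \<sigma>) \<phi>" for x e by simp
  let ?f = "\<lambda>i::nat. if i = 0 then 1 else if even i then i - 2 else i + 2"
  let ?\<sigma> = "case_nat undefined \<sigma>"
  have inj: "inj ?f"
  proof (rule injI)
    show "i = j" if "?f i = ?f j" for i j
      using that by (cases i rule: parity_split; cases j rule: parity_split)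
          (auto split: if_splits, presburger+)
  qed
  have "((interleave e ?\<sigma>)(1 := x)) (?f i) = interleave (case_nat x e) \<sigma> i"
    for x e and i :: nat
    by (cases i rule: parity_split) (auto simp: interleave_def split: nat.split)
  then have "(\<forall>x. P x e) \<longleftrightarrow> sat (interleave e ?\<sigma>) (All 1 (rename ?f \<phi>))" for e
    using P inj by (simp add: sat_rename)
  then show ?thesis unfolding definable_def by blast
qed

lemma definable_const: "definable (\<lambda>e. b)"
proof -
  have "definable (\<lambda>e. e 0 = e 0)"
    unfolding definable_def by (rule exI[of _ "Eq 0 0"]) auto
  from this definable_not[OF this] show ?thesis by (cases b) auto
qed

lemma definable_imp: "definable P \<Longrightarrow> definable Q \<Longrightarrow> definable (\<lambda>e. P e \<longrightarrow> Q e)"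
  using definable_not[OF definable_conj[OF _ definable_not]] by simp

lemma definable_disj: "definable P \<Longrightarrow> definable Q \<Longrightarrow> definable (\<lambda>e. P e \<or> Q e)"
  using definable_imp[OF definable_not, of P Q] by (simp add: disj_imp)

lemma definable_iff: "definable P \<Longrightarrow> definable Q \<Longrightarrow> definable (\<lambda>e. P e \<longleftrightarrow> Q e)"
  using definable_conj[OF definable_imp definable_imp, of P Q Q P] by (simp add: iff_conv_conj_imp)

lemma definable_ex: "definable (\<lambda>e. P (e 0) (\<lambda>i. e (Suc i))) \<Longrightarrow> definable (\<lambda>e. \<exists>x. P x e)"
  using definable_not[OF definable_all, of "\<lambda>x e. \<not> P x e"] definable_not by fastforce

lemma definable_var_mem: "definable (\<lambda>e. e i \<^bold>\<in> e j)"
  unfolding definable_def by (rule exI[of _ "Mem (2 * i) (2 * j)"]) auto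

lemma definable_var_eq: "definable (\<lambda>e. e i = e j)"
  unfolding definable_def by (rule exI[of _ "Eq (2 * i) (2 * j)"]) auto

lemma definable_term_var: "definable_term (\<lambda>e. e i)"
  unfolding definable_term_def by (rule definable_var_eq)

lemma definable_term_const: "definable_term (\<lambda>e. c)"
proof -
  have "e 0 = c \<longleftrightarrow> sat (interleave e (\<lambda>_. c)) (Eq (2 * 0) (Suc (2 * 0)))" for e
    unfolding sat.simps interleave_simps ..
  then show ?thesis unfolding definable_term_def definable_def by blast
qed

lemma definable_weaken:
  assumes "definable (\<lambda>e. P (e 0) (\<lambda>i. e (Suc i)))"
  shows "definable (\<lambda>e. P (e 0) (\<lambda>i. e (Suc (Suc i))))"
  using definable_rename[OF assms, of "case_nat 0 (\<lambda>i. Suc (Suc i))"]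
  by (simp add: inj_def split: nat.split)

lemma definable_term_shift: "definable_term s \<Longrightarrow> definable_term (\<lambda>e. s (\<lambda>i. e (Suc i)))"
  unfolding definable_term_def by (rule definable_weaken[of "\<lambda>x e. x = s e"])

lemma definable_subst:
  assumes "definable (\<lambda>e. P (e 0) (\<lambda>i. e (Suc i)))" "definable_term s"
  shows "definable (\<lambda>e. P (s e) e)"
proof -
  have "definable (\<lambda>e. \<exists>x. x = s e \<and> P x e)"
    using assms unfolding definable_term_def by (intro definable_ex definable_conj)
  then show ?thesis by simp
qed

lemma definable_term_subst:
  assumes "definable_term (\<lambda>e. f (e 0) (\<lambda>i. e (Suc i)))" "definable_term s"
  shows "definable_term (\<lambda>e. f (s e) e)"
proof -
  have "definable (\<lambda>e. e 0 = f (e 1) (\<lambda>i. e (Suc (Suc i))))"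
    using assms(1) unfolding definable_term_def by simp
  from definable_rename[OF this, of "\<lambda>i. if i = 0 then 1 else if i = 1 then 0 else i"]
  have "definable (\<lambda>e. e 1 = f (e 0) (\<lambda>i. e (Suc (Suc i))))"
    by (simp add: inj_def)
  from definable_subst[of "\<lambda>x e. e 0 = f x (\<lambda>i. e (Suc i))", OF _ definable_term_shift[OF assms(2)]] this
  show ?thesis unfolding definable_term_def by simp
qed

text \<open>
  The next lemmas reduce the definability of a relation or operation at arbitrary terms to its
  definability at variables.
\<close>

lemma definable_comp1:
  assumes "definable (\<lambda>e. P (e 0))" "definable_term s"
  shows "definable (\<lambda>e. P (s e))"
  using definable_subst[of "\<lambda>x e. P x"] assms by simp

lemma definable_comp2:
  assumes "definable (\<lambda>e. P (e 0) (e (Suc 0)))" "definable_term s" "definable_term t"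
  shows "definable (\<lambda>e. P (s e) (t e))"
  by (rule definable_subst[of "\<lambda>x e. P (s e) x", OF _ assms(3)],
      rule definable_subst[of "\<lambda>x e. P x (e 0)", OF _ definable_term_shift[OF assms(2)]], rule assms(1))

lemma definable_comp3:
  assumes "definable (\<lambda>e. P (e 0) (e (Suc 0)) (e (Suc (Suc 0))))" "definable_term s" "definable_term t"
      "definable_term u"
  shows "definable (\<lambda>e. P (s e) (t e) (u e))"
  by (rule definable_subst[of "\<lambda>x e. P (s e) (t e) x", OF _ assms(4)],
      rule definable_subst[of "\<lambda>x e. P (s (\<lambda>i. e (Suc i))) x (e 0)", OF _
          definable_term_shift[OF assms(3)]],
      rule definable_subst[of "\<lambda>x e. P x (e 0) (e (Suc 0))", OF _ definable_term_shift[OF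
          definable_term_shift[OF assms(2)]]], rule assms(1))

lemma definable_term_comp1:
  assumes "definable_term (\<lambda>e. f (e 0))" "definable_term s"
  shows "definable_term (\<lambda>e. f (s e))"
  using definable_term_subst[of "\<lambda>x e. f x"] assms by simp

lemma definable_term_comp2:
  assumes "definable_term (\<lambda>e. f (e 0) (e (Suc 0)))" "definable_term s" "definable_term t"
  shows "definable_term (\<lambda>e. f (s e) (t e))"
  by (rule definable_term_subst[of "\<lambda>x e. f (s e) x", OF _ assms(3)],
      rule definable_term_subst[of "\<lambda>x e. f x (e 0)", OF _ definable_term_shift[OF assms(2)]],
          rule assms(1))

lemma definable_mem: "definable_term s \<Longrightarrow> definable_term t \<Longrightarrow> definable (\<lambda>e. s e \<^bold>\<in> t e)"
  by (rule definable_comp2[of "\<lambda>x y. x \<^bold>\<in> y", OF definable_var_mem])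

lemma definable_eq: "definable_term s \<Longrightarrow> definable_term t \<Longrightarrow> definable (\<lambda>e. s e = t e)"
  by (rule definable_comp2[of "\<lambda>x y. x = y", OF definable_var_eq])

text \<open>
  The default value is one fixed element, independent of \<open>P\<close>. With \<open>THE\<close> alone the value at a
  predicate without a unique witness would be unspecified, and \<open>definable_term_description\<close> could fail.
\<close>

definition description :: "('a \<Rightarrow> bool) \<Rightarrow> 'a" where
  "description P = (if \<exists>!x. P x then THE x. P x else undefined)"

lemma description_eq: "P a \<Longrightarrow> (\<And>x. P x \<Longrightarrow> x = a) \<Longrightarrow> description P = a"
  unfolding description_def by (metis the1_equality)

lemma descriptionI: "\<exists>!x. P x \<Longrightarrow> P (description P)"
  unfolding description_def by (simp add: theI')

lemma definable_term_description:
  assumes "definable (\<lambda>e. P (e 0) (\<lambda>i. e (Suc i)))"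
  shows "definable_term (\<lambda>e. description (\<lambda>y. P y e))"
proof -
  have P1: "definable (\<lambda>e. P (e 0) (\<lambda>i. e (Suc (Suc i))))" by (rule definable_weaken[OF assms])
  have P2: "definable (\<lambda>e. P (e 0) (\<lambda>i. e (Suc (Suc (Suc i)))))"
    by (rule definable_weaken[of "\<lambda>x e. P x (\<lambda>i. e (Suc i))", OF P1])
  have "y = description P \<longleftrightarrow> (P y \<and> (\<forall>x. P x \<longrightarrow> x = y)) \<or>
      (\<not> (\<exists>x. P x \<and> (\<forall>z. P z \<longrightarrow> z = x)) \<and> y = undefined)" for y P
  proof (cases "\<exists>!x. P x")
    case True
    then show ?thesis using descriptionI[OF True] by blast
  next
    case False
    then have "description P = undefined" unfolding description_def by simp
    then show ?thesis using False unfolding \<open>description P = undefined\<close> Ex1_def by blast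
  qed
  note eq = this[of _ "\<lambda>y. P y e" for e]
  show ?thesis
    unfolding definable_term_def eq
    by (intro definable_disj definable_conj assms definable_all definable_imp definable_not
        definable_ex definable_eq definable_term_var definable_term_const P1 P2)
qed

lemma definable_term_if: "definable P \<Longrightarrow> definable_term s \<Longrightarrow> definable_term t \<Longrightarrow>
    definable_term (\<lambda>e. if P e then s e else t e)"
proof -
  assume a: "definable P" "definable_term s" "definable_term t"
  have "definable (\<lambda>e. (P (\<lambda>i. e (Suc i)) \<longrightarrow> e 0 = s (\<lambda>i. e (Suc i))) \<and>
      (\<not> P (\<lambda>i. e (Suc i)) \<longrightarrow> e 0 = t (\<lambda>i. e (Suc i))))"
    using a definable_rename[OF a(1), of Suc] unfolding definable_term_def
    by (intro definable_conj definable_imp definable_not) auto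
  then show ?thesis unfolding definable_term_def if_split[of "\<lambda>x. _ = x"] .
qed

text \<open>
  These rules reduce definability to the atoms by the shape of the expression alone.
\<close>

named_theorems definable_intros
lemmas [definable_intros] = definable_const definable_not definable_conj definable_disj definable_imp
    definable_iff definable_all definable_ex definable_mem definable_eq
  definable_term_var definable_term_const definable_term_description definable_term_if

lemma definable_ex1: "definable (\<lambda>e. P (e 0) (\<lambda>i. e (Suc i))) \<Longrightarrow> definable (\<lambda>e. \<exists>!x. P x e)"
  unfolding Ex1_def using definable_weaken by (intro definable_intros)
lemmas [definable_intros] = definable_ex1

lemma definable_subset: "definable_term s \<Longrightarrow> definable_term t \<Longrightarrow> definable (\<lambda>e. s e \<^bold>\<subseteq> t e)"
  by (rule definable_comp2) (unfold subset_def, intro definable_intros)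
lemma definable_is_empty: "definable_term s \<Longrightarrow> definable (\<lambda>e. is_empty (s e))"
  by (rule definable_comp1) (unfold is_empty_def, intro definable_intros)
lemmas [definable_intros] = definable_subset definable_is_empty
lemma definable_is_succ: "definable_term s \<Longrightarrow> definable_term t \<Longrightarrow> definable (\<lambda>e. is_succ (s e) (t e))"
  by (rule definable_comp2) (unfold is_succ_def, intro definable_intros)
lemmas [definable_intros] = definable_is_succ
lemma definable_is_inductive: "definable_term s \<Longrightarrow> definable (\<lambda>e. is_inductive (s e))"
  by (rule definable_comp1) (unfold is_inductive_def, intro definable_intros)
lemmas [definable_intros] = definable_is_inductive
lemma definable_is_omega: "definable_term s \<Longrightarrow> definable (\<lambda>e. is_omega (s e))"
  by (rule definable_comp1) (unfold is_omega_def, intro definable_intros)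
lemmas [definable_intros] = definable_is_omega
lemma definable_is_upair: "definable_term s \<Longrightarrow> definable_term t \<Longrightarrow> definable_term u \<Longrightarrow>
    definable (\<lambda>e. is_upair (s e) (t e) (u e))"
  by (rule definable_comp3) (unfold is_upair_def, intro definable_intros)
lemmas [definable_intros] = definable_is_upair
lemma definable_is_opair: "definable_term s \<Longrightarrow> definable_term t \<Longrightarrow> definable_term u \<Longrightarrow>
    definable (\<lambda>e. is_opair (s e) (t e) (u e))"
  by (rule definable_comp3) (unfold is_opair_def, intro definable_intros)
lemmas [definable_intros] = definable_is_opair
lemma definable_maps_to: "definable_term s \<Longrightarrow> definable_term t \<Longrightarrow> definable_term u \<Longrightarrow>
    definable (\<lambda>e. maps_to (s e) (t e) (u e))"
  by (rule definable_comp3) (unfold maps_to_def, intro definable_intros)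
lemmas [definable_intros] = definable_maps_to
lemma definable_is_function: "definable_term s \<Longrightarrow> definable_term t \<Longrightarrow> definable_term u \<Longrightarrow>
    definable (\<lambda>e. is_function (s e) (t e) (u e))"
  by (rule definable_comp3) (unfold is_function_def, intro definable_intros)
lemmas [definable_intros] = definable_is_function
lemma definable_is_surjection: "definable_term s \<Longrightarrow> definable_term t \<Longrightarrow> definable_term u \<Longrightarrow>
    definable (\<lambda>e. is_surjection (s e) (t e) (u e))"
  by (rule definable_comp3) (unfold is_surjection_def, intro definable_intros)
lemmas [definable_intros] = definable_is_surjection
lemma definable_is_bijection: "definable_term s \<Longrightarrow> definable_term t \<Longrightarrow> definable_term u \<Longrightarrow>
    definable (\<lambda>e. is_bijection (s e) (t e) (u e))"
  by (rule definable_comp3) (unfold is_bijection_def, intro definable_intros)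
lemmas [definable_intros] = definable_is_bijection
lemma definable_Finite: "definable_term s \<Longrightarrow> definable (\<lambda>e. Finite (s e))"
  by (rule definable_comp1) (unfold Finite_def, intro definable_intros)
lemma definable_is_symdiff: "definable_term s \<Longrightarrow> definable_term t \<Longrightarrow> definable_term u \<Longrightarrow>
    definable (\<lambda>e. is_symdiff (s e) (t e) (u e))"
  by (rule definable_comp3) (unfold is_symdiff_def, intro definable_intros)
lemmas [definable_intros] = definable_Finite definable_is_symdiff
lemma definable_is_sum: "definable_term s \<Longrightarrow> definable_term t \<Longrightarrow> definable_term u \<Longrightarrow>
    definable (\<lambda>e. is_sum (s e) (t e) (u e))"
  by (rule definable_comp3) (unfold is_sum_def, intro definable_intros)
lemmas [definable_intros] = definable_is_sum

definition is_set :: "('a \<Rightarrow> bool) \<Rightarrow> bool" where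
  "is_set P \<longleftrightarrow> (\<exists>y. \<forall>z. z \<^bold>\<in> y \<longleftrightarrow> P z)"

definition set_of :: "('a \<Rightarrow> bool) \<Rightarrow> 'a" where
  "set_of P = description (\<lambda>y. \<forall>z. z \<^bold>\<in> y \<longleftrightarrow> P z)"

lemma definable_term_set_of:
  assumes "definable (\<lambda>e. P (e 0) (\<lambda>i. e (Suc i)))"
  shows "definable_term (\<lambda>e. set_of (\<lambda>z. P z e))"
  unfolding set_of_def using definable_weaken[OF assms] by (intro definable_intros)
lemmas [definable_intros] = definable_term_set_of

end

section \<open>Sets in a model\<close>

context ZF_model
begin

lemma eqI: "(\<And>z. z \<^bold>\<in> x \<longleftrightarrow> z \<^bold>\<in> y) \<Longrightarrow> x = y"
  using extensionality by blast

lemma mem_set_of: "is_set P \<Longrightarrow> z \<^bold>\<in> set_of P \<longleftrightarrow> P z"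
proof -
  assume "is_set P"
  then obtain y where y: "\<forall>z. z \<^bold>\<in> y \<longleftrightarrow> P z" unfolding is_set_def by blast
  have "\<exists>!y. \<forall>z. z \<^bold>\<in> y \<longleftrightarrow> P z"
    by (rule ex1I[of _ y], rule y, rule eqI) (simp add: y)
  from descriptionI[OF this] show ?thesis by (simp add: set_of_def)
qed

text \<open>
  Separation and the next lemma, Replacement, are the only places where the axiom schemas are used;
  the schematic variables \<open>0\<close> and \<open>1\<close> have to be matched with the interleaved numbering.
\<close>

lemma is_set_sep:
  assumes "definable (\<lambda>e. P (e 0))"
  shows "is_set (\<lambda>z. z \<^bold>\<in> x \<and> P z)"
proof -
  obtain \<phi> \<sigma> where P: "\<And>e. P (e 0) \<longleftrightarrow> sat (interleave e \<sigma>) \<phi>"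
    using assms unfolding definable_def by blast
  have "P z \<longleftrightarrow> sat ((interleave undefined \<sigma>)(0 := z)) \<phi>" for z
  proof -
    have "interleave (undefined(0 := z)) \<sigma> = (interleave undefined \<sigma>)(0 := z)"
      by (auto simp: interleave_def fun_eq_iff elim!: evenE)
    then show ?thesis using P[of "undefined(0 := z)"] by simp
  qed
  then show ?thesis
    using separation[rule_format, of x "interleave undefined \<sigma>" \<phi>] unfolding is_set_def by simp
qed

lemma is_set_image:
  assumes "definable_term (\<lambda>e. f (e 0))"
  shows "is_set (\<lambda>v. \<exists>u. u \<^bold>\<in> x \<and> v = f u)"
proof -
  have "definable (\<lambda>e. e 0 = f (e 1))"
    using assms unfolding definable_term_def by simp
  then obtain \<phi> \<sigma> where P: "\<And>e. e 0 = f (e 1) \<longleftrightarrow> sat (interleave e \<sigma>) \<phi>"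
    unfolding definable_def by blast
  \<comment> \<open>\<open>e 0\<close> and \<open>e 1\<close> live at indices 0 and 2; the schema wants value and argument at 1 and 0.\<close>
  let ?r = "\<lambda>i::nat. if i = 0 then 1 else if i = 2 then 0 else if i = 1 then 2 else i"
  have inj: "inj ?r" by (auto simp: inj_def split: if_splits)
  define \<rho> where "\<rho> = (\<lambda>i. interleave undefined \<sigma> (if i = 2 then 1 else i))"
  have "(\<rho>(0 := u, 1 := v)) (?r i) = interleave (undefined(0 := v, 1 := u)) \<sigma> i" for u v and i :: nat
    unfolding \<rho>_def by (cases i rule: parity_split) (auto simp: interleave_def)
  then have "v = f u \<longleftrightarrow> sat (\<rho>(0 := u, 1 := v)) (rename ?r \<phi>)" for u v
    using P[of "undefined(0 := v, 1 := u)"] inj by (simp add: sat_rename)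
  note graph = this
  have "\<exists>y. \<forall>v. v \<^bold>\<in> y \<longleftrightarrow> (\<exists>u. u \<^bold>\<in> x \<and> sat (\<rho>(0 := u, 1 := v)) (rename ?r \<phi>))"
    by (rule replacement[rule_format]) (unfold graph[symmetric], blast)
  then show ?thesis unfolding graph[symmetric] is_set_def .
qed

lemma is_set_Union: "is_set (\<lambda>z. \<exists>y. y \<^bold>\<in> x \<and> z \<^bold>\<in> y)"
  using union unfolding is_set_def by blast

lemma is_set_subsets: "is_set (\<lambda>z. z \<^bold>\<subseteq> x)"
  using power_set unfolding is_set_def by blast

lemma is_set_union: "is_set (\<lambda>z. z \<^bold>\<in> x \<or> z \<^bold>\<in> y)"
proof -
  obtain p where "is_upair x y p" using pairing by blast
  then show ?thesis using is_set_Union[of p] unfolding is_set_def is_upair_def by metis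
qed

lemma is_set_insert: "is_set (\<lambda>z. z = a \<or> z \<^bold>\<in> x)"
proof -
  obtain p where "is_upair a a p" using pairing by blast
  then show ?thesis using is_set_union[of p x] unfolding is_set_def is_upair_def by metis
qed

definition emp :: 'a where "emp = set_of (\<lambda>z. False)"
definition ins :: "'a \<Rightarrow> 'a \<Rightarrow> 'a" where "ins a x = set_of (\<lambda>z. z = a \<or> z \<^bold>\<in> x)"
definition del :: "'a \<Rightarrow> 'a \<Rightarrow> 'a" where "del x a = set_of (\<lambda>z. z \<^bold>\<in> x \<and> z \<noteq> a)"
definition cup :: "'a \<Rightarrow> 'a \<Rightarrow> 'a" where "cup x y = set_of (\<lambda>z. z \<^bold>\<in> x \<or> z \<^bold>\<in> y)"
definition cap :: "'a \<Rightarrow> 'a \<Rightarrow> 'a" where "cap x y = set_of (\<lambda>z. z \<^bold>\<in> x \<and> z \<^bold>\<in> y)"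
definition symdiff :: "'a \<Rightarrow> 'a \<Rightarrow> 'a" where "symdiff x y = set_of (\<lambda>z. z \<^bold>\<in> cup x y \<and>
    \<not> (z \<^bold>\<in> x \<longleftrightarrow> z \<^bold>\<in> y))"
definition powerset :: "'a \<Rightarrow> 'a" where "powerset x = set_of (\<lambda>z. z \<^bold>\<subseteq> x)"
definition bigcup :: "'a \<Rightarrow> 'a" where "bigcup x = set_of (\<lambda>z. \<exists>y. y \<^bold>\<in> x \<and> z \<^bold>\<in> y)"
definition img :: "('a \<Rightarrow> 'a) \<Rightarrow> 'a \<Rightarrow> 'a" where "img f x = set_of (\<lambda>v. \<exists>u. u \<^bold>\<in> x \<and> v = f u)"

lemma mem_emp [simp]: "\<not> z \<^bold>\<in> emp"
proof -
  have "is_set (\<lambda>z. False)"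
    using infinity unfolding is_set_def is_inductive_def is_empty_def by blast
  then show ?thesis by (simp add: emp_def mem_set_of)
qed

lemma mem_ins [simp]: "z \<^bold>\<in> ins a x \<longleftrightarrow> z = a \<or> z \<^bold>\<in> x"
  by (simp add: ins_def mem_set_of is_set_insert)

lemma mem_cup [simp]: "z \<^bold>\<in> cup x y \<longleftrightarrow> z \<^bold>\<in> x \<or> z \<^bold>\<in> y"
  by (simp add: cup_def mem_set_of is_set_union)

lemma mem_del [simp]: "z \<^bold>\<in> del x a \<longleftrightarrow> z \<^bold>\<in> x \<and> z \<noteq> a"
  unfolding del_def by (rule mem_set_of, rule is_set_sep) (intro definable_intros)

lemma mem_cap [simp]: "z \<^bold>\<in> cap x y \<longleftrightarrow> z \<^bold>\<in> x \<and> z \<^bold>\<in> y"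
  unfolding cap_def by (rule mem_set_of, rule is_set_sep) (intro definable_intros)

lemma mem_symdiff [simp]: "z \<^bold>\<in> symdiff x y \<longleftrightarrow> \<not> (z \<^bold>\<in> x \<longleftrightarrow> z \<^bold>\<in> y)"
proof -
  have "z \<^bold>\<in> symdiff x y \<longleftrightarrow> z \<^bold>\<in> cup x y \<and> \<not> (z \<^bold>\<in> x \<longleftrightarrow> z \<^bold>\<in> y)"
    unfolding symdiff_def by (rule mem_set_of, rule is_set_sep) (intro definable_intros)
  then show ?thesis by auto
qed

lemma mem_powerset [simp]: "z \<^bold>\<in> powerset x \<longleftrightarrow> z \<^bold>\<subseteq> x"
  by (simp add: powerset_def mem_set_of is_set_subsets)

lemma mem_bigcup [simp]: "z \<^bold>\<in> bigcup x \<longleftrightarrow> (\<exists>y. y \<^bold>\<in> x \<and> z \<^bold>\<in> y)"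
  by (simp add: bigcup_def mem_set_of is_set_Union)

lemma mem_img: "definable_term (\<lambda>e. f (e 0)) \<Longrightarrow> z \<^bold>\<in> img f x \<longleftrightarrow> (\<exists>u. u \<^bold>\<in> x \<and> z = f u)"
  by (simp add: img_def mem_set_of is_set_image)

lemma definable_term_ins: "definable_term s \<Longrightarrow> definable_term t \<Longrightarrow> definable_term (\<lambda>e. ins (s e) (t e))"
  by (rule definable_term_comp2) (unfold ins_def, intro definable_intros)
lemma definable_term_del: "definable_term s \<Longrightarrow> definable_term t \<Longrightarrow> definable_term (\<lambda>e. del (s e) (t e))"
  by (rule definable_term_comp2) (unfold del_def, intro definable_intros)
lemma definable_term_cup: "definable_term s \<Longrightarrow> definable_term t \<Longrightarrow> definable_term (\<lambda>e. cup (s e) (t e))"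
  by (rule definable_term_comp2) (unfold cup_def, intro definable_intros)
lemma definable_term_cap: "definable_term s \<Longrightarrow> definable_term t \<Longrightarrow> definable_term (\<lambda>e. cap (s e) (t e))"
  by (rule definable_term_comp2) (unfold cap_def, intro definable_intros)
lemmas [definable_intros] = definable_term_ins definable_term_del definable_term_cup definable_term_cap
lemma definable_term_symdiff: "definable_term s \<Longrightarrow> definable_term t \<Longrightarrow>
    definable_term (\<lambda>e. symdiff (s e) (t e))"
  by (rule definable_term_comp2) (unfold symdiff_def, intro definable_intros)
lemma definable_term_powerset: "definable_term s \<Longrightarrow> definable_term (\<lambda>e. powerset (s e))"
  by (rule definable_term_comp1) (unfold powerset_def, intro definable_intros)
lemma definable_term_bigcup: "definable_term s \<Longrightarrow> definable_term (\<lambda>e. bigcup (s e))"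
  by (rule definable_term_comp1) (unfold bigcup_def, intro definable_intros)
lemmas [definable_intros] = definable_term_symdiff definable_term_powerset definable_term_bigcup

lemma is_empty_iff: "is_empty z \<longleftrightarrow> z = emp"
  unfolding is_empty_def using eqI mem_emp by blast

lemma is_symdiff_iff: "is_symdiff x y d \<longleftrightarrow> d = symdiff x y"
  unfolding is_symdiff_def using eqI[of d "symdiff x y"] mem_symdiff by blast

lemma sub_eqI: "x \<^bold>\<subseteq> y \<Longrightarrow> y \<^bold>\<subseteq> x \<Longrightarrow> x = y"
  unfolding subset_def using eqI by blast

lemma subset_emp [simp]: "emp \<^bold>\<subseteq> x" by (simp add: subset_def)
lemma subset_refl [simp]: "x \<^bold>\<subseteq> x" by (simp add: subset_def)

lemma nonempty: "x \<noteq> emp \<Longrightarrow> \<exists>a. a \<^bold>\<in> x"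
  using eqI[of x emp] by auto

lemma ins_del: "a \<^bold>\<in> x \<Longrightarrow> ins a (del x a) = x" by (rule eqI) auto
lemma del_ins: "\<not> a \<^bold>\<in> x \<Longrightarrow> del (ins a x) a = x" by (rule eqI) auto
lemma ins_not_emp [simp]: "ins a x \<noteq> emp" by (metis mem_emp mem_ins)

definition pair :: "'a \<Rightarrow> 'a \<Rightarrow> 'a" where
  "pair x y = ins (ins x (ins x emp)) (ins (ins x (ins y emp)) emp)"

lemma definable_term_pair: "definable_term s \<Longrightarrow> definable_term t \<Longrightarrow> definable_term (\<lambda>e. pair (s e) (t e))"
  by (rule definable_term_comp2) (unfold pair_def, intro definable_intros)
lemmas [definable_intros] = definable_term_pair

lemma is_upair_iff: "is_upair x y p \<longleftrightarrow> p = ins x (ins y emp)"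
  unfolding is_upair_def using eqI[of p "ins x (ins y emp)"] by auto

lemma is_opair_iff: "is_opair x y p \<longleftrightarrow> p = pair x y"
  unfolding is_opair_def is_upair_iff pair_def by simp

lemma pair_inject [simp]: "pair x y = pair x' y' \<longleftrightarrow> x = x' \<and> y = y'"
proof
  have doubleton: "ins a (ins b emp) = ins c (ins d emp) \<longleftrightarrow> (a = c \<and> b = d) \<or> (a = d \<and> b = c)" for a b c d
    using eqI[of "ins a (ins b emp)" "ins c (ins d emp)"] mem_ins mem_emp by metis
  assume "pair x y = pair x' y'"
  then show "x = x' \<and> y = y'"
    unfolding pair_def doubleton by auto
qed simp

lemma maps_to_iff: "maps_to f x y \<longleftrightarrow> pair x y \<^bold>\<in> f"
  unfolding maps_to_def is_opair_iff by simp

definition app :: "'a \<Rightarrow> 'a \<Rightarrow> 'a" where "app f x = description (\<lambda>y. maps_to f x y)"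

definition graph :: "('a \<Rightarrow> 'a) \<Rightarrow> 'a \<Rightarrow> 'a" where "graph f x = img (\<lambda>z. pair z (f z)) x"

text \<open>
  Functions of the model and definable HOL functions are interchangeable: \<open>graph\<close> turns the latter
  into the former, and \<open>app\<close> goes back. Constructions of functions can thus be made in HOL.
\<close>

abbreviation definable_fun :: "('a \<Rightarrow> 'a) \<Rightarrow> bool" where "definable_fun f \<equiv> definable_term (\<lambda>e. f (e 0))"

lemma definable_term_app: "definable_term s \<Longrightarrow> definable_term t \<Longrightarrow> definable_term (\<lambda>e. app (s e) (t e))"
  by (rule definable_term_comp2) (unfold app_def, intro definable_intros)
lemmas [definable_intros] = definable_term_app

lemma mem_graph:
  assumes "definable_fun f"
  shows "z \<^bold>\<in> graph f x \<longleftrightarrow> (\<exists>u. u \<^bold>\<in> x \<and> z = pair u (f u))"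
  unfolding graph_def by (rule mem_img) (intro definable_intros assms)

lemma maps_to_graph: "definable_fun f \<Longrightarrow> maps_to (graph f x) a b \<longleftrightarrow> a \<^bold>\<in> x \<and> b = f a"
  unfolding maps_to_iff by (auto simp: mem_graph)

lemma is_function_graph:
  assumes "definable_fun f" "\<And>z. z \<^bold>\<in> x \<Longrightarrow> f z \<^bold>\<in> y"
  shows "is_function (graph f x) x y"
  using assms unfolding is_function_def is_opair_iff by (auto simp: maps_to_graph mem_graph)

lemma maps_to_app:
  assumes "is_function f x y"
  shows "maps_to f a b \<longleftrightarrow> a \<^bold>\<in> x \<and> b = app f a"
proof -
  have "maps_to f a b \<Longrightarrow> a \<^bold>\<in> x"
    using assms unfolding is_function_def is_opair_iff maps_to_iff by auto
  moreover have "maps_to f a (app f a)" if "a \<^bold>\<in> x"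
    using assms that descriptionI[of "maps_to f a"] unfolding is_function_def app_def by blast
  ultimately show ?thesis
    using assms unfolding is_function_def by blast
qed

lemma app_in: "is_function f x y \<Longrightarrow> a \<^bold>\<in> x \<Longrightarrow> app f a \<^bold>\<in> y"
  using maps_to_app[of f x y a "app f a"] unfolding is_function_def is_opair_iff maps_to_iff by auto

definition bij :: "('a \<Rightarrow> 'a) \<Rightarrow> 'a \<Rightarrow> 'a \<Rightarrow> bool" where
  "bij f x y \<longleftrightarrow> (\<forall>z. z \<^bold>\<in> x \<longrightarrow> f z \<^bold>\<in> y) \<and> (\<forall>b. b \<^bold>\<in> y \<longrightarrow> (\<exists>a. a \<^bold>\<in> x \<and> f a = b)) \<and>
    (\<forall>a a'. a \<^bold>\<in> x \<and> a' \<^bold>\<in> x \<and> f a = f a' \<longrightarrow> a = a')"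

lemma bij_mem: "bij f x y \<Longrightarrow> a \<^bold>\<in> x \<Longrightarrow> f a \<^bold>\<in> y"
  and bij_inj: "bij f x y \<Longrightarrow> a \<^bold>\<in> x \<Longrightarrow> b \<^bold>\<in> x \<Longrightarrow> f a = f b \<Longrightarrow> a = b"
  unfolding bij_def by blast+

lemma bij_surj:
  assumes "bij f x y" "b \<^bold>\<in> y"
  obtains a where "a \<^bold>\<in> x" "f a = b"
  using assms unfolding bij_def by blast

lemma bijI:
  assumes "\<And>a. a \<^bold>\<in> x \<Longrightarrow> f a \<^bold>\<in> y" "\<And>b. b \<^bold>\<in> y \<Longrightarrow> \<exists>a. a \<^bold>\<in> x \<and> f a = b"
    "\<And>a b. a \<^bold>\<in> x \<Longrightarrow> b \<^bold>\<in> x \<Longrightarrow> f a = f b \<Longrightarrow> a = b"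
  shows "bij f x y"
  using assms unfolding bij_def by blast

lemma is_bijection_graph:
  assumes "definable_fun f" "bij f x y"
  shows "is_bijection (graph f x) x y"
  using assms is_function_graph[of f x y]
  unfolding is_bijection_def is_surjection_def bij_def by (auto simp: maps_to_graph)

lemma bij_app:
  assumes "is_bijection f x y"
  shows "bij (app f) x y"
proof -
  have f: "is_function f x y" using assms unfolding is_bijection_def is_surjection_def by blast
  then show ?thesis
    using assms app_in[OF f] unfolding is_bijection_def is_surjection_def maps_to_app[OF f] bij_def
    by blast
qed

lemma definable_fun_app: "definable_fun (app f)" by (intro definable_intros)

lemma bij_inverse:
  assumes "definable_fun f" "bij f x y"
  obtains g where "definable_fun g" "bij g y x"
proof -
  define g where "g = (\<lambda>b. description (\<lambda>a. a \<^bold>\<in> x \<and> f a = b))"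
  have definable_fun: "definable_fun g"
    unfolding g_def by (intro definable_intros definable_term_comp1[of f, OF assms(1)])
  have inj: "a = a'" if "a \<^bold>\<in> x" "a' \<^bold>\<in> x" "f a = f a'" for a a'
    using that assms(2) unfolding bij_def by blast
  have g: "g b \<^bold>\<in> x \<and> f (g b) = b" if b: "b \<^bold>\<in> y" for b
  proof -
    obtain a where "a \<^bold>\<in> x" "f a = b" using assms(2) b unfolding bij_def by blast
    then have "\<exists>!a. a \<^bold>\<in> x \<and> f a = b" using inj by (intro ex1I[of _ a]) auto
    then show ?thesis unfolding g_def by (rule descriptionI)
  qed
  have gf: "f a \<^bold>\<in> y \<and> g (f a) = a" if "a \<^bold>\<in> x" for a
  proof -
    have "f a \<^bold>\<in> y" using that assms(2) unfolding bij_def by blast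
    with g[OF this] show ?thesis using inj that by simp
  qed
  have "bij g y x"
    unfolding bij_def
  proof (intro conjI allI impI)
    show "\<exists>b. b \<^bold>\<in> y \<and> g b = a" if "a \<^bold>\<in> x" for a using gf[OF that] by blast
    show "b = b'" if "b \<^bold>\<in> y \<and> b' \<^bold>\<in> y \<and> g b = g b'" for b b' using that g by metis
    show "g b \<^bold>\<in> x" if "b \<^bold>\<in> y" for b using g[OF that] by blast
  qed
  with definable_fun show ?thesis by (rule that)
qed

section \<open>Natural numbers of a model\<close>

definition succ :: "'a \<Rightarrow> 'a" where "succ n = ins n n"

definition omega :: 'a where "omega = description is_omega"

lemma definable_term_succ: "definable_term s \<Longrightarrow> definable_term (\<lambda>e. succ (s e))"
  by (rule definable_term_comp1) (unfold succ_def, intro definable_intros)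
lemmas [definable_intros] = definable_term_succ

lemma mem_succ [simp]: "k \<^bold>\<in> succ n \<longleftrightarrow> k = n \<or> k \<^bold>\<in> n"
  by (simp add: succ_def)

lemma is_succ_iff: "is_succ x y \<longleftrightarrow> y = succ x"
  unfolding is_succ_def using eqI[of y "succ x"] by auto

lemma is_inductive_iff: "is_inductive v \<longleftrightarrow> emp \<^bold>\<in> v \<and> (\<forall>x. x \<^bold>\<in> v \<longrightarrow> succ x \<^bold>\<in> v)"
  unfolding is_inductive_def is_empty_iff is_succ_iff by auto

lemma is_omega_unique: "is_omega v \<Longrightarrow> is_omega w \<Longrightarrow> v = w"
  unfolding is_omega_def by (auto intro: sub_eqI)

lemma is_omega_omega: "is_omega omega"
proof -
  obtain v where v: "is_inductive v" using infinity by blast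
  define w where "w = set_of (\<lambda>n. n \<^bold>\<in> v \<and> (\<forall>u. is_inductive u \<longrightarrow> n \<^bold>\<in> u))"
  have w: "n \<^bold>\<in> w \<longleftrightarrow> n \<^bold>\<in> v \<and> (\<forall>u. is_inductive u \<longrightarrow> n \<^bold>\<in> u)" for n
    unfolding w_def by (rule mem_set_of, rule is_set_sep) (intro definable_intros)
  have "is_inductive w"
    using v unfolding is_inductive_iff[of w] w by (auto simp: is_inductive_iff)
  then have "is_omega w"
    unfolding is_omega_def subset_def using w by auto
  then have "\<exists>!w. is_omega w" using is_omega_unique by (metis (no_types))
  then show ?thesis
    unfolding omega_def by (rule descriptionI[of is_omega])
qed

lemma is_omega_iff: "is_omega w \<longleftrightarrow> w = omega"
  using is_omega_omega is_omega_unique by blast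

lemma emp_omega [simp]: "emp \<^bold>\<in> omega" and succ_omega [simp]: "n \<^bold>\<in> omega \<Longrightarrow> succ n \<^bold>\<in> omega"
  using is_omega_omega unfolding is_omega_def is_inductive_iff by auto

lemma omega_least:
  assumes "emp \<^bold>\<in> v" "\<And>n. n \<^bold>\<in> v \<Longrightarrow> succ n \<^bold>\<in> v" "n \<^bold>\<in> omega"
  shows "n \<^bold>\<in> v"
proof -
  have "is_inductive v" using assms(1,2) by (simp add: is_inductive_iff)
  with is_omega_omega assms(3) show ?thesis unfolding is_omega_def subset_def by blast
qed

lemma omega_induct [consumes 1, case_names definable emp succ]:
  assumes "n \<^bold>\<in> omega" "definable (\<lambda>e. P (e 0))" "P emp" "\<And>n. n \<^bold>\<in> omega \<Longrightarrow> P n \<Longrightarrow> P (succ n)"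
  shows "P n"
proof -
  define v where "v = set_of (\<lambda>n. n \<^bold>\<in> omega \<and> P n)"
  have v: "n \<^bold>\<in> v \<longleftrightarrow> n \<^bold>\<in> omega \<and> P n" for n
    unfolding v_def by (rule mem_set_of, rule is_set_sep) (rule assms(2))
  have "n \<^bold>\<in> v"
    by (rule omega_least) (use assms in \<open>auto simp: v\<close>)
  then show ?thesis using v by blast
qed

lemma omega_cases:
  assumes "n \<^bold>\<in> omega"
  obtains "n = emp" | k where "k \<^bold>\<in> omega" "n = succ k"
proof -
  have "n = emp \<or> (\<exists>k. k \<^bold>\<in> omega \<and> n = succ k)"
    using assms by (induction n rule: omega_induct) (intro definable_intros | blast)+
  then show ?thesis using that by blast
qed

lemma succ_not_emp [simp]: "succ n \<noteq> emp" by (simp add: succ_def)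

lemma omega_trans: "n \<^bold>\<in> omega \<Longrightarrow> k \<^bold>\<in> n \<Longrightarrow> k \<^bold>\<in> omega"
proof -
  assume "n \<^bold>\<in> omega"
  then have "\<forall>k. k \<^bold>\<in> n \<longrightarrow> k \<^bold>\<in> omega"
    by (induction n rule: omega_induct) (intro definable_intros | simp)+
  then show "k \<^bold>\<in> n \<Longrightarrow> k \<^bold>\<in> omega" by blast
qed

lemma less_trans: "n \<^bold>\<in> omega \<Longrightarrow> k \<^bold>\<in> n \<Longrightarrow> j \<^bold>\<in> k \<Longrightarrow> j \<^bold>\<in> n"
proof -
  assume "n \<^bold>\<in> omega"
  then have "\<forall>k. k \<^bold>\<in> n \<longrightarrow> (\<forall>j. j \<^bold>\<in> k \<longrightarrow> j \<^bold>\<in> n)"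
    by (induction n rule: omega_induct) (intro definable_intros | simp | blast)+
  then show "k \<^bold>\<in> n \<Longrightarrow> j \<^bold>\<in> k \<Longrightarrow> j \<^bold>\<in> n" by blast
qed

lemma omega_minimal:
  assumes "definable (\<lambda>e. P (e 0))" "n \<^bold>\<in> omega" "P n"
  obtains m where "m \<^bold>\<in> omega" "P m" "\<And>k. k \<^bold>\<in> m \<Longrightarrow> \<not> P k"
proof -
  define v where "v = set_of (\<lambda>n. n \<^bold>\<in> omega \<and> P n)"
  have v: "n \<^bold>\<in> v \<longleftrightarrow> n \<^bold>\<in> omega \<and> P n" for n
    unfolding v_def by (rule mem_set_of, rule is_set_sep) (rule assms(1))
  have "\<exists>m. m \<^bold>\<in> v \<and> \<not> (\<exists>z. z \<^bold>\<in> v \<and> z \<^bold>\<in> m)"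
    using foundation[rule_format, of v] assms v by blast
  then show ?thesis using that omega_trans v by blast
qed

lemma less_irrefl: "\<not> n \<^bold>\<in> n"
  using foundation[rule_format, of "ins n emp"] by auto

lemma less_linear: "k \<^bold>\<in> omega \<Longrightarrow> n \<^bold>\<in> omega \<Longrightarrow> k \<^bold>\<in> n \<or> k = n \<or> n \<^bold>\<in> k"
proof -
  assume k: "k \<^bold>\<in> omega"
  have zero: "emp = n \<or> emp \<^bold>\<in> n" if "n \<^bold>\<in> omega" for n
    using that by (induction n rule: omega_induct) (intro definable_intros | auto)+
  have mono: "\<forall>k. k \<^bold>\<in> n \<longrightarrow> succ k = n \<or> succ k \<^bold>\<in> n" if "n \<^bold>\<in> omega" for n
    using that by (induction n rule: omega_induct) (intro definable_intros | simp | blast)+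
  from k have "\<forall>n. n \<^bold>\<in> omega \<longrightarrow> k \<^bold>\<in> n \<or> k = n \<or> n \<^bold>\<in> k"
  proof (induction k rule: omega_induct)
    case definable
    show ?case by (intro definable_intros)
  next
    case emp
    show ?case using zero by blast
  next
    case (succ k)
    show ?case using succ mono mem_succ by metis
  qed
  then show "n \<^bold>\<in> omega \<Longrightarrow> k \<^bold>\<in> n \<or> k = n \<or> n \<^bold>\<in> k" by blast
qed

definition le :: "'a \<Rightarrow> 'a \<Rightarrow> bool" where "le m n \<longleftrightarrow> m = n \<or> m \<^bold>\<in> n"

lemma definable_le: "definable_term s \<Longrightarrow> definable_term t \<Longrightarrow> definable (\<lambda>e. le (s e) (t e))"
  by (rule definable_comp2) (unfold le_def, intro definable_intros)
lemmas [definable_intros] = definable_le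

lemma le_refl [simp]: "le n n" by (simp add: le_def)
lemma less_imp_le: "m \<^bold>\<in> n \<Longrightarrow> le m n" by (simp add: le_def)
lemma mem_succ_le: "m \<^bold>\<in> succ n \<longleftrightarrow> le m n" by (simp add: le_def)
lemma le_trans: "n \<^bold>\<in> omega \<Longrightarrow> le k m \<Longrightarrow> le m n \<Longrightarrow> le k n"
  unfolding le_def using less_trans by blast
lemma le_less_trans: "n \<^bold>\<in> omega \<Longrightarrow> le k m \<Longrightarrow> m \<^bold>\<in> n \<Longrightarrow> k \<^bold>\<in> n"
  unfolding le_def using less_trans by blast
lemma not_le: "m \<^bold>\<in> omega \<Longrightarrow> n \<^bold>\<in> omega \<Longrightarrow> \<not> le m n \<longleftrightarrow> n \<^bold>\<in> m"
  unfolding le_def using less_linear less_irrefl less_trans by blast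
lemma le_emp: "le n emp \<longleftrightarrow> n = emp" by (simp add: le_def)
lemma emp_le: "n \<^bold>\<in> omega \<Longrightarrow> le emp n"
  using not_le[of emp n] by auto
lemma le_omega: "n \<^bold>\<in> omega \<Longrightarrow> le m n \<Longrightarrow> m \<^bold>\<in> omega"
  unfolding le_def using omega_trans by blast
lemma succ_le: "m \<^bold>\<in> omega \<Longrightarrow> n \<^bold>\<in> omega \<Longrightarrow> le (succ m) n \<longleftrightarrow> m \<^bold>\<in> n"
  by (metis not_le mem_succ_le succ_omega)
lemma succ_inject: "m \<^bold>\<in> omega \<Longrightarrow> n \<^bold>\<in> omega \<Longrightarrow> succ m = succ n \<longleftrightarrow> m = n"
  by (metis mem_succ less_irrefl less_trans)

section \<open>Finite sets of a model and their sizes\<close>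

definition has_size :: "'a \<Rightarrow> 'a \<Rightarrow> bool" where "has_size n x \<longleftrightarrow> (\<exists>e. is_bijection e n x)"

definition card_of :: "'a \<Rightarrow> 'a" where "card_of x = description (\<lambda>n. n \<^bold>\<in> omega \<and> has_size n x)"

definition size_le :: "'a \<Rightarrow> 'a \<Rightarrow> bool" where "size_le n x \<longleftrightarrow> Finite x \<and> le (card_of x) n"

lemma definable_has_size: "definable_term s \<Longrightarrow> definable_term t \<Longrightarrow> definable (\<lambda>e. has_size (s e) (t e))"
  by (rule definable_comp2) (unfold has_size_def, intro definable_intros)
lemmas [definable_intros] = definable_has_size
lemma definable_term_card_of: "definable_term s \<Longrightarrow> definable_term (\<lambda>e. card_of (s e))"
  by (rule definable_term_comp1) (unfold card_of_def, intro definable_intros)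
lemmas [definable_intros] = definable_term_card_of
lemma definable_size_le: "definable_term s \<Longrightarrow> definable_term t \<Longrightarrow> definable (\<lambda>e. size_le (s e) (t e))"
  by (rule definable_comp2) (unfold size_le_def, intro definable_intros)
lemmas [definable_intros] = definable_size_le

lemma has_size_iff: "has_size n x \<longleftrightarrow> (\<exists>f. definable_fun f \<and> bij f n x)"
  unfolding has_size_def using is_bijection_graph bij_app definable_fun_app by blast

lemma has_size_emp: "has_size emp x \<longleftrightarrow> x = emp"
proof
  assume "has_size emp x"
  then obtain f where "bij f emp x" unfolding has_size_iff by blast
  then have "\<not> z \<^bold>\<in> x" for z using bij_surj[of f emp x z] by auto
  then show "x = emp" using nonempty by blast
next
  assume "x = emp"
  then have "bij (\<lambda>z. z) emp x" by (intro bijI) auto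
  moreover have "definable_fun (\<lambda>z. z)" by (rule definable_term_var)
  ultimately show "has_size emp x" unfolding has_size_iff by (intro exI[of _ "\<lambda>z. z"] conjI)
qed

lemma bij_peel:
  assumes f: "bij f (succ n) x"
  shows "f n \<^bold>\<in> x" "bij f n (del x (f n))"
proof -
  show "f n \<^bold>\<in> x" using bij_mem[OF f] by simp
  show "bij f n (del x (f n))"
  proof (rule bijI)
    show "f k \<^bold>\<in> del x (f n)" if "k \<^bold>\<in> n" for k
      using that bij_mem[OF f, of k] bij_inj[OF f, of k n] less_irrefl[of n] by auto
    show "\<exists>k. k \<^bold>\<in> n \<and> f k = b" if b: "b \<^bold>\<in> del x (f n)" for b
    proof -
      have "b \<^bold>\<in> x" using b by simp
      then obtain k where "k \<^bold>\<in> succ n" "f k = b" by (rule bij_surj[OF f])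
      then show ?thesis using b by auto
    qed
    show "k = k'" if "k \<^bold>\<in> n" "k' \<^bold>\<in> n" "f k = f k'" for k k'
      using that bij_inj[OF f, of k k'] by simp
  qed
qed

text \<open>
  Together with \<open>bij_peel\<close> this turns the enumerations in the definitions of size and of sum into
  recursions on the length (\<open>has_size_succ\<close> and \<open>sum_along_succ\<close>).
\<close>

lemma bij_extend:
  assumes f: "bij f n (del x y)" and "y \<^bold>\<in> x"
  shows "bij (\<lambda>k. if k = n then y else f k) (succ n) x"
proof -
  define g where "g = (\<lambda>k. if k = n then y else f k)"
  have g: "g n = y" "\<And>k. k \<^bold>\<in> n \<Longrightarrow> g k = f k \<and> f k \<^bold>\<in> x \<and> f k \<noteq> y"
    using less_irrefl bij_mem[OF f] by (auto simp: g_def)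
  have "bij g (succ n) x"
  proof (rule bijI)
    show "g k \<^bold>\<in> x" if "k \<^bold>\<in> succ n" for k
      using that assms(2) g by auto
    show "\<exists>k. k \<^bold>\<in> succ n \<and> g k = b" if b: "b \<^bold>\<in> x" for b
    proof (cases "b = y")
      case True
      then show ?thesis using g(1) by (intro exI[of _ n]) simp
    next
      case False
      then have "b \<^bold>\<in> del x y" using b by simp
      then obtain k where "k \<^bold>\<in> n" "f k = b" by (rule bij_surj[OF f])
      then show ?thesis using g by (intro exI[of _ k]) simp
    qed
    show "k = k'" if "k \<^bold>\<in> succ n" "k' \<^bold>\<in> succ n" "g k = g k'" for k k'
      using that g(1) g(2)[of k] g(2)[of k'] bij_inj[OF f, of k k']
      by (cases "k = n"; cases "k' = n") auto
  qed
  then show ?thesis unfolding g_def .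
qed

lemma has_size_succ: "has_size (succ n) x \<longleftrightarrow> (\<exists>y. y \<^bold>\<in> x \<and> has_size n (del x y))"
proof
  assume "has_size (succ n) x"
  then obtain f where f: "definable_fun f" "bij f (succ n) x" unfolding has_size_iff by blast
  then show "\<exists>y. y \<^bold>\<in> x \<and> has_size n (del x y)" using bij_peel[OF f(2)] unfolding has_size_iff by blast
next
  assume "\<exists>y. y \<^bold>\<in> x \<and> has_size n (del x y)"
  then obtain y f where f: "y \<^bold>\<in> x" "definable_fun f" "bij f n (del x y)" unfolding has_size_iff by blast
  have "definable_fun (\<lambda>k. if k = n then y else f k)" by (intro definable_intros f(2))
  with bij_extend[OF f(3,1)] show "has_size (succ n) x"
    unfolding has_size_iff by (intro exI[of _ "\<lambda>k. if k = n then y else f k"] conjI)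
qed

lemma del_del: "del (del x y) a = del (del x a) y" by (rule eqI) auto

text \<open>
  The recursion in \<open>has_size_succ\<close> removes some element; this removes a prescribed one. If the
  enumeration ends with \<open>y\<close>, then \<open>a\<close> is removed from the rest by the induction hypothesis and \<open>y\<close>
  is put back at the end. No entries have to be exchanged, and uniqueness of the size follows.
\<close>

lemma has_size_del:
  assumes "n \<^bold>\<in> omega" "has_size n x" "a \<^bold>\<in> x"
  obtains m where "m \<^bold>\<in> omega" "n = succ m" "has_size m (del x a)"
proof -
  have "\<forall>x. has_size n x \<longrightarrow> (\<forall>a. a \<^bold>\<in> x \<longrightarrow> (\<exists>m. m \<^bold>\<in> omega \<and> n = succ m \<and> has_size m (del x a)))"
    using assms(1)
  proof (induction n rule: omega_induct)
    case definable
    show ?case by (intro definable_intros)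
  next
    case emp
    show ?case by (auto simp: has_size_emp)
  next
    case (succ n)
    show ?case
    proof (intro allI impI)
      fix x a assume "has_size (succ n) x" and a: "a \<^bold>\<in> x"
      then obtain y where y: "y \<^bold>\<in> x" "has_size n (del x y)" unfolding has_size_succ by blast
      have "has_size n (del x a)"
      proof (cases "a = y")
        case False
        then have "a \<^bold>\<in> del x y" using a by simp
        then obtain m where m: "n = succ m" "has_size m (del (del x y) a)" using succ y(2) by blast
        then have "has_size m (del (del x a) y)" using del_del by simp
        then show ?thesis unfolding m(1) has_size_succ using y(1) False by auto
      qed (use y in simp)
      then show "\<exists>m. m \<^bold>\<in> omega \<and> succ n = succ m \<and> has_size m (del x a)" using succ by blast
    qed
  qed
  then show ?thesis using that assms by blast
qed

lemma has_size_unique: "n \<^bold>\<in> omega \<Longrightarrow> m \<^bold>\<in> omega \<Longrightarrow> has_size n x \<Longrightarrow> has_size m x \<Longrightarrow> n = m"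
proof -
  assume "n \<^bold>\<in> omega"
  then have "\<forall>m x. m \<^bold>\<in> omega \<longrightarrow> has_size n x \<longrightarrow> has_size m x \<longrightarrow> n = m"
  proof (induction n rule: omega_induct)
    case definable
    show ?case by (intro definable_intros)
  next
    case emp
    show ?case
    proof (intro allI impI)
      fix m x assume "m \<^bold>\<in> omega" "has_size emp x" "has_size m x"
      then show "emp = m" by (cases m rule: omega_cases) (auto simp: has_size_emp has_size_succ)
    qed
  next
    case (succ n)
    show ?case
    proof (intro allI impI)
      fix m x assume m: "m \<^bold>\<in> omega" "has_size (succ n) x" "has_size m x"
      then obtain y where y: "y \<^bold>\<in> x" "has_size n (del x y)" unfolding has_size_succ by blast
      from has_size_del[OF m(1,3) y(1)] obtain k where "k \<^bold>\<in> omega" "m = succ k" "has_size k (del x y)" .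
      then show "succ n = m" using succ y by blast
    qed
  qed
  then show "m \<^bold>\<in> omega \<Longrightarrow> has_size n x \<Longrightarrow> has_size m x \<Longrightarrow> n = m" by blast
qed

lemma Finite_iff: "Finite x \<longleftrightarrow> (\<exists>n. n \<^bold>\<in> omega \<and> has_size n x)"
proof -
  have "(\<exists>f. is_bijection f x n) \<longleftrightarrow> has_size n x" for n
  proof
    assume "\<exists>f. is_bijection f x n"
    then obtain f where "is_bijection f x n" ..
    from bij_inverse[OF definable_fun_app bij_app[OF this]] show "has_size n x"
        unfolding has_size_iff by blast
  next
    assume "has_size n x"
    then obtain f where "definable_fun f" "bij f n x" unfolding has_size_iff by blast
    from bij_inverse[OF this] obtain g where "definable_fun g" "bij g x n" .
    then show "\<exists>f. is_bijection f x n" using is_bijection_graph by blast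
  qed
  then show ?thesis unfolding Finite_def is_omega_iff by simp
qed

lemma card_of_eq: "n \<^bold>\<in> omega \<Longrightarrow> has_size n x \<Longrightarrow> card_of x = n"
  unfolding card_of_def by (rule description_eq) (auto dest: has_size_unique)

lemma card_of_omega: "Finite x \<Longrightarrow> card_of x \<^bold>\<in> omega" and has_size_card: "Finite x \<Longrightarrow>
    has_size (card_of x) x"
  unfolding Finite_iff using card_of_eq by auto

lemma Finite_emp [simp]: "Finite emp" and card_of_emp [simp]: "card_of emp = emp"
  using card_of_eq[of emp emp] by (auto simp: has_size_emp Finite_iff intro!: exI[of _ emp])

lemma card_of_eq_emp: "Finite x \<Longrightarrow> card_of x = emp \<longleftrightarrow> x = emp"
  using has_size_card[of x] has_size_emp[of x] by auto

lemma Finite_ins_new: "Finite x \<Longrightarrow> \<not> a \<^bold>\<in> x \<Longrightarrow> Finite (ins a x) \<and> card_of (ins a x) = succ (card_of x)"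
proof -
  assume "Finite x" "\<not> a \<^bold>\<in> x"
  then have "has_size (succ (card_of x)) (ins a x)" "succ (card_of x) \<^bold>\<in> omega"
    unfolding has_size_succ by (auto intro!: exI[of _ a] simp: del_ins has_size_card card_of_omega)
  then show ?thesis using card_of_eq Finite_iff by blast
qed

lemma Finite_ins: "Finite x \<Longrightarrow> Finite (ins a x)"
proof (cases "a \<^bold>\<in> x")
  case True
  then have "ins a x = x" by (intro eqI) auto
  then show "Finite x \<Longrightarrow> ?thesis" by simp
qed (use Finite_ins_new in blast)

lemma Finite_del_mem: "Finite x \<Longrightarrow> a \<^bold>\<in> x \<Longrightarrow> Finite (del x a) \<and> card_of x = succ (card_of (del x a))"
  by (metis has_size_del has_size_card card_of_omega card_of_eq Finite_iff)

lemma Finite_induct [consumes 1, case_names definable emp ins]: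
  assumes "Finite x" "definable (\<lambda>e. P (e 0))" "P emp"
    "\<And>x a. Finite x \<Longrightarrow> \<not> a \<^bold>\<in> x \<Longrightarrow> P x \<Longrightarrow> P (ins a x)"
  shows "P x"
proof -
  have "\<forall>x. has_size n x \<longrightarrow> P x" if "n \<^bold>\<in> omega" for n
    using that
  proof (induction n rule: omega_induct)
    case definable
    show ?case by (intro definable_intros definable_comp1[OF assms(2)])
  next
    case emp
    show ?case using assms(3) by (simp add: has_size_emp)
  next
    case (succ n)
    show ?case
    proof (intro allI impI)
      fix x assume "has_size (succ n) x"
      then obtain y where y: "y \<^bold>\<in> x" "has_size n (del x y)" unfolding has_size_succ by blast
      have "P (ins y (del x y))"
        by (rule assms(4)) (use y succ Finite_iff in auto)
      then show "P x" using ins_del y by simp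
    qed
  qed
  then show ?thesis using assms(1) unfolding Finite_iff by blast
qed

lemma subset_card_of: "Finite x \<Longrightarrow> y \<^bold>\<subseteq> x \<Longrightarrow> Finite y \<and> le (card_of y) (card_of x)"
proof -
  assume "Finite x"
  then have "\<forall>y. y \<^bold>\<subseteq> x \<longrightarrow> Finite y \<and> le (card_of y) (card_of x)"
  proof (induction x rule: Finite_induct)
    case definable
    show ?case by (intro definable_intros)
  next
    case emp
    show ?case
    proof (intro allI impI)
      fix y assume "y \<^bold>\<subseteq> emp"
      then have "y = emp" by (intro sub_eqI) auto
      then show "Finite y \<and> le (card_of y) (card_of emp)" by simp
    qed
  next
    case (ins x a)
    note x = Finite_ins_new[OF ins(1,2)]
    show ?case
    proof (intro allI impI)
      fix y assume y: "y \<^bold>\<subseteq> ins a x"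
      show "Finite y \<and> le (card_of y) (card_of (ins a x))"
      proof (cases "a \<^bold>\<in> y")
        case True
        have "del y a \<^bold>\<subseteq> x" using y unfolding subset_def by auto
        then have d: "Finite (del y a)" "le (card_of (del y a)) (card_of x)" using ins(3) by blast+
        then have "Finite (ins a (del y a)) \<and> card_of (ins a (del y a)) = succ (card_of (del y a))"
          using Finite_ins_new by simp
        moreover have "le (succ (card_of (del y a))) (succ (card_of x))"
          using d ins(1) card_of_omega succ_le mem_succ_le by simp
        ultimately show ?thesis using x ins_del[OF True] by simp
      next
        case False
        then have "y \<^bold>\<subseteq> x" using y unfolding subset_def by auto
        then show ?thesis
          using ins(3) x mem_succ_le less_imp_le by metis
      qed
    qed
  qed
  then show "y \<^bold>\<subseteq> x \<Longrightarrow> Finite y \<and> le (card_of y) (card_of x)" by blast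
qed

lemma Finite_subset: "Finite x \<Longrightarrow> y \<^bold>\<subseteq> x \<Longrightarrow> Finite y"
  using subset_card_of by blast

lemma psubset_card_of:
  assumes "Finite x" "y \<^bold>\<subseteq> x" "a \<^bold>\<in> x" "\<not> a \<^bold>\<in> y"
  shows "card_of y \<^bold>\<in> card_of x"
proof -
  have "y \<^bold>\<subseteq> del x a" using assms unfolding subset_def by auto
  then have "le (card_of y) (card_of (del x a))" using subset_card_of Finite_del_mem assms by blast
  then show ?thesis using Finite_del_mem[OF assms(1,3)] by (simp add: mem_succ_le del: mem_succ)
qed

lemma Finite_cup: "Finite x \<Longrightarrow> Finite y \<Longrightarrow> Finite (cup x y)"
proof (induction x rule: Finite_induct)
  case definable
  show ?case by (intro definable_intros)
next
  case emp
  have "cup emp y = y" by (rule eqI) auto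
  then show ?case using emp by simp
next
  case (ins x a)
  have "cup (ins a x) y = ins a (cup x y)" by (rule eqI) auto
  then show ?case using ins Finite_ins by simp
qed

lemma Finite_img: "definable_fun f \<Longrightarrow> Finite x \<Longrightarrow> Finite (img f x)"
proof -
  assume f: "definable_fun f" and "Finite x"
  have definable_term: "definable_term (\<lambda>e. img f (e 0))"
    unfolding img_def by (intro definable_intros definable_term_comp1[of f, OF f])
  show ?thesis
    using \<open>Finite x\<close>
  proof (induction x rule: Finite_induct)
    case definable
    show ?case by (intro definable_intros definable_term)
  next
    case emp
    have "img f emp = emp" by (rule eqI) (simp add: mem_img f)
    then show ?case by simp
  next
    case (ins x a)
    have "img f (ins a x) = ins (f a) (img f x)" by (rule eqI) (auto simp: mem_img f)
    then show ?case using ins Finite_ins by simp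
  qed
qed

lemma Finite_bigcup: "Finite x \<Longrightarrow> (\<And>y. y \<^bold>\<in> x \<Longrightarrow> Finite y) \<Longrightarrow> Finite (bigcup x)"
proof -
  assume "Finite x"
  then have "(\<forall>y. y \<^bold>\<in> x \<longrightarrow> Finite y) \<longrightarrow> Finite (bigcup x)"
  proof (induction x rule: Finite_induct)
    case definable
    show ?case by (intro definable_intros)
  next
    case emp
    have "bigcup emp = emp" by (rule eqI) auto
    then show ?case by simp
  next
    case (ins x a)
    have "bigcup (ins a x) = cup a (bigcup x)" by (rule eqI) auto
    then show ?case using ins Finite_cup by simp
  qed
  then show "(\<And>y. y \<^bold>\<in> x \<Longrightarrow> Finite y) \<Longrightarrow> Finite (bigcup x)" by blast
qed

lemma Finite_powerset: "Finite x \<Longrightarrow> Finite (powerset x)"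
proof (induction x rule: Finite_induct)
  case definable
  show ?case by (intro definable_intros)
next
  case emp
  have "powerset emp = ins emp emp"
    by (rule eqI) (auto intro!: sub_eqI)
  then show ?case by (simp add: Finite_ins)
next
  case (ins x a)
  have definable_term: "definable_fun (ins a)" by (intro definable_intros)
  have "powerset (ins a x) = cup (powerset x) (img (ins a) (powerset x))"
  proof (rule eqI)
    fix z
    have "z \<^bold>\<subseteq> ins a x \<longleftrightarrow> z \<^bold>\<subseteq> x \<or> (\<exists>u. u \<^bold>\<subseteq> x \<and> z = ins a u)"
    proof
      assume z: "z \<^bold>\<subseteq> ins a x"
      show "z \<^bold>\<subseteq> x \<or> (\<exists>u. u \<^bold>\<subseteq> x \<and> z = ins a u)"
      proof (cases "a \<^bold>\<in> z")
        case True
        have "del z a \<^bold>\<subseteq> x" using z unfolding subset_def by auto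
        then show ?thesis using ins_del[OF True] by metis
      qed (use z in \<open>auto simp: subset_def\<close>)
    qed (auto simp: subset_def)
    then show "z \<^bold>\<in> powerset (ins a x) \<longleftrightarrow> z \<^bold>\<in> cup (powerset x) (img (ins a) (powerset x))"
      by (simp add: mem_img[OF definable_term])
  qed
  then show ?case using ins Finite_cup Finite_img definable_term by simp
qed

lemma Finite_inj:
  assumes "definable_fun f" "Finite y" "\<And>a. a \<^bold>\<in> x \<Longrightarrow> f a \<^bold>\<in> y"
    "\<And>a b. a \<^bold>\<in> x \<Longrightarrow> b \<^bold>\<in> x \<Longrightarrow> f a = f b \<Longrightarrow> a = b"
  shows "Finite x"
proof -
  have "img f x \<^bold>\<subseteq> y" using assms(3) by (auto simp: subset_def mem_img assms(1))
  then have fin: "Finite (img f x)" using Finite_subset assms(2) by blast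
  have "bij f x (img f x)"
    by (rule bijI) (use assms(4) in \<open>auto simp: mem_img assms(1)\<close>)
  then obtain g where g: "definable_fun g" "bij g (img f x) x" using bij_inverse assms(1) by blast
  have "img g (img f x) = x"
    using bij_mem[OF g(2)] bij_surj[OF g(2)] by (intro eqI) (metis mem_img[of g, OF g(1)])
  then show ?thesis using Finite_img[OF g(1) fin] by simp
qed

lemma size_le_subset: "n \<^bold>\<in> omega \<Longrightarrow> size_le n x \<Longrightarrow> y \<^bold>\<subseteq> x \<Longrightarrow> size_le n y"
  unfolding size_le_def using subset_card_of le_trans by blast

lemma size_le_mono: "n \<^bold>\<in> omega \<Longrightarrow> le m n \<Longrightarrow> size_le m x \<Longrightarrow> size_le n x"
  unfolding size_le_def using le_trans by blast

lemma size_le_ins: "n \<^bold>\<in> omega \<Longrightarrow> size_le n x \<Longrightarrow> size_le (succ n) (ins a x)"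
proof (cases "a \<^bold>\<in> x")
  case True
  then have "ins a x = x" by (intro eqI) auto
  then show "n \<^bold>\<in> omega \<Longrightarrow> size_le n x \<Longrightarrow> ?thesis"
      using size_le_mono[of "succ n" n x] by (simp add: le_def)
next
  case False
  then show "n \<^bold>\<in> omega \<Longrightarrow> size_le n x \<Longrightarrow> ?thesis"
    unfolding size_le_def using Finite_ins_new succ_le card_of_omega mem_succ_le succ_omega by metis
qed

lemma size_le_succD:
  assumes "n \<^bold>\<in> omega" "size_le (succ n) x"
  obtains a y where "size_le n y" "x \<^bold>\<subseteq> ins a y"
proof (cases "x = emp")
  case True
  then show ?thesis using that[of emp] assms(1) by (simp add: size_le_def emp_le)
next
  case False
  then obtain a where a: "a \<^bold>\<in> x" using nonempty by blast
  have x: "Finite (del x a)" "card_of x = succ (card_of (del x a))"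
    using Finite_del_mem a assms(2) unfolding size_le_def by blast+
  then have "card_of (del x a) \<^bold>\<in> succ n"
    using assms succ_le card_of_omega unfolding size_le_def by simp
  then have "size_le n (del x a)" using x mem_succ_le unfolding size_le_def by blast
  then show ?thesis using that[of "del x a" a] ins_del[OF a] by simp
qed

lemma size_le_cup:
  assumes "n \<^bold>\<in> omega"
  obtains m where "m \<^bold>\<in> omega" "\<And>x y. size_le n x \<Longrightarrow> size_le n y \<Longrightarrow> size_le m (cup x y)"
proof -
  have "\<exists>m. m \<^bold>\<in> omega \<and> (\<forall>x y. size_le n x \<longrightarrow> size_le n y \<longrightarrow> size_le m (cup x y))"
    using assms
  proof (induction n rule: omega_induct)
    case definable
    show ?case by (intro definable_intros)
  next
    case emp
    have "cup emp emp = emp" by (rule eqI) auto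
    then show ?case by (intro exI[of _ emp]) (auto simp: size_le_def le_emp card_of_eq_emp)
  next
    case (succ n)
    then obtain m where m: "m \<^bold>\<in> omega" "\<And>x y. size_le n x \<Longrightarrow> size_le n y \<Longrightarrow> size_le m (cup x y)" by blast
    show ?case
    proof (intro exI[of _ "succ (succ m)"] conjI allI impI)
      fix x y assume "size_le (succ n) x" "size_le (succ n) y"
      from this[THEN size_le_succD[OF succ(1)]] obtain a x' b y'
        where x: "size_le n x'" "x \<^bold>\<subseteq> ins a x'" and y: "size_le n y'" "y \<^bold>\<subseteq> ins b y'" by metis
      have "size_le (succ (succ m)) (ins a (ins b (cup x' y')))"
        using m x(1) y(1) by (intro size_le_ins) auto
      moreover have "cup x y \<^bold>\<subseteq> ins a (ins b (cup x' y'))"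
        using x(2) y(2) unfolding subset_def by auto
      ultimately show "size_le (succ (succ m)) (cup x y)" using size_le_subset m(1) by simp
    qed (use m in simp)
  qed
  then show ?thesis using that by blast
qed

section \<open>Sums of finite sets of group elements\<close>

text \<open>
  This is the body of \<open>is_sum\<close> for an enumeration of length \<open>n\<close>, isolated for induction on \<open>n\<close>.
\<close>

definition sum_along :: "'a \<Rightarrow> 'a \<Rightarrow> 'a \<Rightarrow> 'a \<Rightarrow> bool" where
  "sum_along G n F t \<longleftrightarrow> (\<exists>m e s. is_succ n m \<and> is_bijection e n F \<and> is_function s m G \<and>
     (\<exists>z. is_empty z \<and> maps_to s z z) \<and>
     (\<forall>k. k \<^bold>\<in> n \<longrightarrow> (\<exists>k' y a b. is_succ k k' \<and> maps_to e k y \<and>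
        maps_to s k a \<and> maps_to s k' b \<and> is_symdiff a y b)) \<and>
     maps_to s n t)"

lemma definable_sum_along: "definable_term s \<Longrightarrow> definable_term t \<Longrightarrow> definable_term u \<Longrightarrow>
    definable (\<lambda>e. sum_along G (s e) (t e) (u e))"
  by (rule definable_comp3) (unfold sum_along_def, intro definable_intros)
lemmas [definable_intros] = definable_sum_along

lemma is_sum_iff: "is_sum G F t \<longleftrightarrow> (\<exists>n. n \<^bold>\<in> omega \<and> sum_along G n F t)"
  unfolding is_sum_def sum_along_def is_omega_iff by simp

lemma sum_along_iff:
  assumes "n \<^bold>\<in> omega"
  shows "sum_along G n F t \<longleftrightarrow> (\<exists>f s. definable_fun f \<and> definable_fun s \<and> bij f n F \<and>
      (\<forall>k. k \<^bold>\<in> succ n \<longrightarrow> s k \<^bold>\<in> G) \<and>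
    s emp = emp \<and> (\<forall>k. k \<^bold>\<in> n \<longrightarrow> s (succ k) = symdiff (s k) (f k)) \<and> s n = t)"
proof -
  have zero: "emp \<^bold>\<in> succ n" using emp_le[OF assms] by (simp add: mem_succ_le del: mem_succ)
  have suc: "succ k \<^bold>\<in> succ n" if "k \<^bold>\<in> n" for k
    using that assms succ_le[of k n] omega_trans mem_succ_le by blast
  show ?thesis
  proof
    assume "sum_along G n F t"
    then obtain e s where e: "is_bijection e n F" and s: "is_function s (succ n) G"
      and s0: "maps_to s emp emp" and sn: "maps_to s n t"
      and step: "\<And>k. k \<^bold>\<in> n \<Longrightarrow> \<exists>y a. maps_to e k y \<and> maps_to s k a \<and> maps_to s (succ k) (symdiff a y)"
      unfolding sum_along_def is_succ_iff is_empty_iff is_symdiff_iff by auto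
    have "is_function e n F" using e unfolding is_bijection_def is_surjection_def by blast
    note me = maps_to_app[OF this] and ms = maps_to_app[OF s]
    have "app s (succ k) = symdiff (app s k) (app e k)" if "k \<^bold>\<in> n" for k
      using step[OF that] unfolding me ms by auto
    moreover have "app s emp = emp" "app s n = t" using s0 sn unfolding ms by auto
    ultimately show "\<exists>f s. definable_fun f \<and> definable_fun s \<and> bij f n F \<and> (\<forall>k. k \<^bold>\<in> succ n \<longrightarrow> s k \<^bold>\<in> G) \<and>
      s emp = emp \<and> (\<forall>k. k \<^bold>\<in> n \<longrightarrow> s (succ k) = symdiff (s k) (f k)) \<and> s n = t"
      using bij_app[OF e] app_in[OF s] definable_fun_app[of e] definable_fun_app[of s]
      by (intro exI[of _ "app e"] exI[of _ "app s"] conjI) simp_all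
  next
    assume "\<exists>f s. definable_fun f \<and> definable_fun s \<and> bij f n F \<and> (\<forall>k. k \<^bold>\<in> succ n \<longrightarrow> s k \<^bold>\<in> G) \<and>
      s emp = emp \<and> (\<forall>k. k \<^bold>\<in> n \<longrightarrow> s (succ k) = symdiff (s k) (f k)) \<and> s n = t"
    then obtain f s where f: "definable_fun f" "bij f n F"
        and s: "definable_fun s" "\<And>k. k \<^bold>\<in> succ n \<Longrightarrow> s k \<^bold>\<in> G"
      and eqs: "s emp = emp" "\<And>k. k \<^bold>\<in> n \<Longrightarrow> s (succ k) = symdiff (s k) (f k)" "s n = t" by blast
    show "sum_along G n F t"
      unfolding sum_along_def is_succ_iff is_empty_iff is_symdiff_iff
    proof (rule exI[of _ "succ n"], rule exI[of _ "graph f n"], rule exI[of _ "graph s (succ n)"],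
        intro conjI allI impI)
      show "is_bijection (graph f n) n F" using is_bijection_graph[OF f] .
      show "is_function (graph s (succ n)) (succ n) G" using is_function_graph[OF s] .
      show "\<exists>z. z = emp \<and> maps_to (graph s (succ n)) z z"
        using eqs(1) zero by (simp add: maps_to_graph[OF s(1)] del: mem_succ)
      show "maps_to (graph s (succ n)) n t"
        using eqs(3) by (simp add: maps_to_graph[OF s(1)])
      show "\<exists>k' y a b. k' = succ k \<and> maps_to (graph f n) k y \<and> maps_to (graph s (succ n)) k a \<and>
          maps_to (graph s (succ n)) k' b \<and> b = symdiff a y" if k: "k \<^bold>\<in> n" for k
        using k suc[OF k] eqs(2)[OF k]
        by (intro exI[of _ "succ k"] exI[of _ "f k"] exI[of _ "s k"] exI[of _ "symdiff (s k) (f k)"])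
          (simp add: maps_to_graph[OF s(1)] maps_to_graph[OF f(1)] del: mem_succ, simp)
    qed (rule refl)
  qed
qed

lemma symdiff_symdiff: "symdiff (symdiff t y) y = t" by (rule eqI) auto
lemma symdiff_self: "symdiff t t = emp" by (rule eqI) auto
lemma symdiff_emp: "symdiff t emp = t" by (rule eqI) auto
lemma symdiff_swap: "symdiff (symdiff t x) y = symdiff (symdiff t y) x" by (rule eqI) auto

lemma sum_along_emp:
  assumes "emp \<^bold>\<in> G"
  shows "sum_along G emp F t \<longleftrightarrow> F = emp \<and> t = emp"
proof
  assume "sum_along G emp F t"
  then obtain f s where f: "definable_fun f" "bij f emp F" and s: "s emp = emp" "s emp = t"
    unfolding sum_along_iff[OF emp_omega] by blast
  have "has_size emp F" unfolding has_size_iff using f by blast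
  then show "F = emp \<and> t = emp" using s has_size_emp by simp
next
  assume a: "F = emp \<and> t = emp"
  have "bij (\<lambda>z. z) emp F" using a by (intro bijI) auto
  moreover have "definable_fun (\<lambda>z. z)" by (rule definable_term_var)
  moreover have "definable_fun (\<lambda>z. emp)" by (rule definable_term_const)
  ultimately show "sum_along G emp F t"
    unfolding sum_along_iff[OF emp_omega] using a assms
    by (intro exI[of _ "\<lambda>z. z"] exI[of _ "\<lambda>z. emp"] conjI) simp_all
qed

lemma sum_along_succ:
  assumes G: "\<And>x y. x \<^bold>\<in> G \<Longrightarrow> y \<^bold>\<in> G \<Longrightarrow> symdiff x y \<^bold>\<in> G" and F: "F \<^bold>\<subseteq> G" and n: "n \<^bold>\<in> omega"
  shows "sum_along G (succ n) F t \<longleftrightarrow> (\<exists>y. y \<^bold>\<in> F \<and> sum_along G n (del F y) (symdiff t y))"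
proof
  assume "sum_along G (succ n) F t"
  then obtain f s where f: "definable_fun f" "bij f (succ n) F"
    and s: "definable_fun s" "\<And>k. k \<^bold>\<in> succ (succ n) \<Longrightarrow> s k \<^bold>\<in> G" "s emp = emp"
      "\<And>k. k \<^bold>\<in> succ n \<Longrightarrow> s (succ k) = symdiff (s k) (f k)" "s (succ n) = t"
    unfolding sum_along_iff[OF succ_omega[OF n]] by blast
  note p = bij_peel[OF f(2)]
  have "s n = symdiff t (f n)" using s(4)[of n] s(5) by (simp add: symdiff_symdiff)
  then have "sum_along G n (del F (f n)) (symdiff t (f n))"
    unfolding sum_along_iff[OF n] using f(1) p(2) s
    by (intro exI[of _ f] exI[of _ s] conjI) simp_all
  then show "\<exists>y. y \<^bold>\<in> F \<and> sum_along G n (del F y) (symdiff t y)" using p(1) by blast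
next
  assume "\<exists>y. y \<^bold>\<in> F \<and> sum_along G n (del F y) (symdiff t y)"
  then obtain y f s where y: "y \<^bold>\<in> F" and f: "definable_fun f" "bij f n (del F y)"
    and s: "definable_fun s" "\<And>k. k \<^bold>\<in> succ n \<Longrightarrow> s k \<^bold>\<in> G" "s emp = emp"
      "\<And>k. k \<^bold>\<in> n \<Longrightarrow> s (succ k) = symdiff (s k) (f k)" "s n = symdiff t y"
    unfolding sum_along_iff[OF n] by blast
  define f' where "f' = (\<lambda>k. if k = n then y else f k)"
  define s' where "s' = (\<lambda>k. if k = succ n then t else s k)"
  have "definable_fun f'" unfolding f'_def by (intro definable_intros f(1))
  moreover have "definable_fun s'" unfolding s'_def by (intro definable_intros s(1))
  moreover have "bij f' (succ n) F" unfolding f'_def by (rule bij_extend[OF f(2) y])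
  moreover have "s' k \<^bold>\<in> G" if "k \<^bold>\<in> succ (succ n)" for k
  proof (cases "k = succ n")
    case True
    have "symdiff t y \<^bold>\<in> G" using s(2)[of n] s(5) by simp
    moreover have "y \<^bold>\<in> G" using y F unfolding subset_def by blast
    ultimately have "symdiff (symdiff t y) y \<^bold>\<in> G" by (rule G)
    then show ?thesis using True by (simp add: s'_def symdiff_symdiff)
  qed (use that s(2) in \<open>auto simp: s'_def\<close>)
  moreover have "s' emp = emp" using s(3) succ_not_emp[of n, symmetric] by (simp add: s'_def)
  moreover have "s' (succ k) = symdiff (s' k) (f' k)" if k: "k \<^bold>\<in> succ n" for k
  proof (cases "k = n")
    case True
    have "n \<noteq> succ n" using less_irrefl[of n] mem_succ[of n n] by metis
    then have "s' n = symdiff t y" using s(5) by (simp add: s'_def)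
    then show ?thesis using True by (simp add: s'_def f'_def symdiff_symdiff)
  next
    case False
    then have kn: "k \<^bold>\<in> n" using k by simp
    then have "k \<noteq> succ n" using less_irrefl[of "succ n"] mem_succ[of k n] by metis
    moreover have "succ k \<noteq> succ n" using False kn omega_trans[OF n kn] succ_inject n by blast
    ultimately show ?thesis using s(4)[OF kn] False by (simp add: s'_def f'_def)
  qed
  moreover have "s' (succ n) = t" by (simp add: s'_def)
  ultimately show "sum_along G (succ n) F t"
    unfolding sum_along_iff[OF succ_omega[OF n]] by (intro exI[of _ f'] exI[of _ s'] conjI allI impI)
qed

text \<open>
  This is the independence of a sum from the order of its terms, with the same proof as
  \<open>has_size_del\<close>: every element can be made the last one.
\<close>

lemma sum_along_del:
  assumes G: "emp \<^bold>\<in> G" "\<And>x y. x \<^bold>\<in> G \<Longrightarrow> y \<^bold>\<in> G \<Longrightarrow> symdiff x y \<^bold>\<in> G"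
    and "n \<^bold>\<in> omega" "F \<^bold>\<subseteq> G" "sum_along G n F t" "a \<^bold>\<in> F"
  obtains m where "m \<^bold>\<in> omega" "n = succ m" "sum_along G m (del F a) (symdiff t a)"
proof -
  have "\<forall>F t. F \<^bold>\<subseteq> G \<longrightarrow> sum_along G n F t \<longrightarrow> (\<forall>a. a \<^bold>\<in> F \<longrightarrow> (\<exists>m. m \<^bold>\<in> omega \<and> n = succ m \<and>
      sum_along G m (del F a) (symdiff t a)))"
    using assms(3)
  proof (induction n rule: omega_induct)
    case definable
    show ?case by (intro definable_intros)
  next
    case emp
    show ?case by (auto simp: sum_along_emp[OF G(1)])
  next
    case (succ n)
    show ?case
    proof (intro allI impI)
      fix F t a assume F: "F \<^bold>\<subseteq> G" and "sum_along G (succ n) F t" and a: "a \<^bold>\<in> F"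
      then obtain y where y: "y \<^bold>\<in> F" "sum_along G n (del F y) (symdiff t y)"
        using sum_along_succ[OF G(2) F succ(1)] by blast
      have sub: "del F z \<^bold>\<subseteq> G" for z using F unfolding subset_def by simp
      have "sum_along G n (del F a) (symdiff t a)"
      proof (cases "a = y")
        case False
        then have "a \<^bold>\<in> del F y" using a by simp
        then obtain m where m: "m \<^bold>\<in> omega" "n = succ m"
            "sum_along G m (del (del F y) a) (symdiff (symdiff t y) a)"
          using succ(2) sub y(2) by blast
        then have "sum_along G m (del (del F a) y) (symdiff (symdiff t a) y)"
            using del_del symdiff_swap by simp
        moreover have "y \<^bold>\<in> del F a" using y(1) False by simp
        ultimately have "sum_along G (succ m) (del F a) (symdiff t a)"
          using sum_along_succ[OF G(2) sub[of a] m(1)] by blast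
        then show ?thesis using m(2) by simp
      qed (use y in simp)
      then show "\<exists>m. m \<^bold>\<in> omega \<and> succ n = succ m \<and> sum_along G m (del F a) (symdiff t a)"
          using succ by blast
    qed
  qed
  then show ?thesis using that assms by blast
qed

text \<open>
  Subtraction equals addition in this group, so adding \<open>y\<close> to a sum either appends \<open>y\<close> or cancels it.
\<close>

lemma is_sum_toggle:
  assumes G: "emp \<^bold>\<in> G" "\<And>x y. x \<^bold>\<in> G \<Longrightarrow> y \<^bold>\<in> G \<Longrightarrow> symdiff x y \<^bold>\<in> G"
    and Y: "Y \<^bold>\<subseteq> G" "F \<^bold>\<subseteq> Y" "y \<^bold>\<in> Y" and "is_sum G F t"
  shows "\<exists>F'. F' \<^bold>\<subseteq> Y \<and> is_sum G F' (symdiff t y)"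
proof -
  obtain n where n: "n \<^bold>\<in> omega" "sum_along G n F t" using assms(6) unfolding is_sum_iff by blast
  have F: "F \<^bold>\<subseteq> G" using Y(1,2) unfolding subset_def by blast
  show ?thesis
  proof (cases "y \<^bold>\<in> F")
    case True
    from sum_along_del[OF G n(1) F n(2) True]
        obtain m where "m \<^bold>\<in> omega" "sum_along G m (del F y) (symdiff t y)" .
    moreover have "del F y \<^bold>\<subseteq> Y" using Y(2) unfolding subset_def by simp
    ultimately show ?thesis unfolding is_sum_iff by blast
  next
    case False
    have sub: "ins y F \<^bold>\<subseteq> Y" using Y unfolding subset_def by simp
    then have "ins y F \<^bold>\<subseteq> G" using Y(1) unfolding subset_def by blast
    note suc = sum_along_succ[OF G(2) this n(1)]
    have "sum_along G n (del (ins y F) y) (symdiff (symdiff t y) y)"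
        using n False by (simp add: symdiff_symdiff del_ins)
    moreover have "y \<^bold>\<in> ins y F" by simp
    ultimately have "sum_along G (succ n) (ins y F) (symdiff t y)" using suc by blast
    then show ?thesis using n(1) sub succ_omega unfolding is_sum_iff by blast
  qed
qed

text \<open>
  The terms of the second sum are toggled in the first one, one after the other.
\<close>

lemma is_sum_symdiff:
  assumes G: "emp \<^bold>\<in> G" "\<And>x y. x \<^bold>\<in> G \<Longrightarrow> y \<^bold>\<in> G \<Longrightarrow> symdiff x y \<^bold>\<in> G"
    and Y: "Y \<^bold>\<subseteq> G" "F \<^bold>\<subseteq> Y" "F' \<^bold>\<subseteq> Y" and sums: "is_sum G F t" "is_sum G F' t'"
  shows "\<exists>E. E \<^bold>\<subseteq> Y \<and> is_sum G E (symdiff t t')"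
proof -
  have "\<forall>F' t' F t. F' \<^bold>\<subseteq> Y \<longrightarrow> sum_along G n F' t' \<longrightarrow> F \<^bold>\<subseteq> Y \<longrightarrow> is_sum G F t \<longrightarrow>
      (\<exists>E. E \<^bold>\<subseteq> Y \<and> is_sum G E (symdiff t t'))" if "n \<^bold>\<in> omega" for n
    using that
  proof (induction n rule: omega_induct)
    case definable
    show ?case by (intro definable_intros)
  next
    case emp
    show ?case by (auto simp: sum_along_emp[OF G(1)] symdiff_emp)
  next
    case (succ n)
    show ?case
    proof (intro allI impI)
      fix F' t' F t
      assume a: "F' \<^bold>\<subseteq> Y" "sum_along G (succ n) F' t'" "F \<^bold>\<subseteq> Y" "is_sum G F t"
      have "F' \<^bold>\<subseteq> G" using a(1) Y(1) unfolding subset_def by blast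
      from sum_along_succ[OF G(2) this succ(1)] a(2)
      obtain y where y: "y \<^bold>\<in> F'" "sum_along G n (del F' y) (symdiff t' y)" by blast
      have "y \<^bold>\<in> Y" and sub: "del F' y \<^bold>\<subseteq> Y" using y(1) a(1) unfolding subset_def by auto
      from is_sum_toggle[OF G Y(1) a(3) this(1) a(4)]
      obtain E where E: "E \<^bold>\<subseteq> Y" "is_sum G E (symdiff t y)" by blast
      have "symdiff (symdiff t y) (symdiff t' y) = symdiff t t'" by (rule eqI) auto
      then show "\<exists>E. E \<^bold>\<subseteq> Y \<and> is_sum G E (symdiff t t')"
        using succ(2) sub y(2) E by metis
    qed
  qed
  then show ?thesis using Y sums unfolding is_sum_iff by blast
qed

lemma is_sum_Finite: "is_sum G F t \<Longrightarrow> Finite F"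
  unfolding is_sum_iff sum_along_def Finite_iff has_size_def by blast

lemma is_sum_mem: "is_sum G F t \<Longrightarrow> t \<^bold>\<in> G"
proof -
  assume "is_sum G F t"
  then obtain n where n: "n \<^bold>\<in> omega" "sum_along G n F t" unfolding is_sum_iff by blast
  then obtain s where "\<And>k. k \<^bold>\<in> succ n \<Longrightarrow> s k \<^bold>\<in> G" "s n = t" unfolding sum_along_iff[OF n(1)] by blast
  then show "t \<^bold>\<in> G" by auto
qed

text \<open>
  The empty sum contributes \<open>\<emptyset>\<close>, which need not belong to \<open>FS(Y)\<close>; with it, the finite sums form the
  group generated by \<open>Y\<close>.
\<close>

lemma FS_span:
  assumes G: "emp \<^bold>\<in> G" "\<And>x y. x \<^bold>\<in> G \<Longrightarrow> y \<^bold>\<in> G \<Longrightarrow> symdiff x y \<^bold>\<in> G" and Y: "Y \<^bold>\<subseteq> G"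
  obtains S where "is_FS G Y S" "S \<^bold>\<subseteq> G" "Y \<^bold>\<subseteq> S"
    "\<And>x y. x \<^bold>\<in> ins emp S \<Longrightarrow> y \<^bold>\<in> ins emp S \<Longrightarrow> symdiff x y \<^bold>\<in> ins emp S"
proof -
  define S where "S = set_of (\<lambda>t. t \<^bold>\<in> G \<and> (\<exists>F. F \<^bold>\<subseteq> Y \<and> Finite F \<and> \<not> is_empty F \<and> is_sum G F t))"
  have "t \<^bold>\<in> S \<longleftrightarrow> t \<^bold>\<in> G \<and> (\<exists>F. F \<^bold>\<subseteq> Y \<and> Finite F \<and> \<not> is_empty F \<and> is_sum G F t)" for t
    unfolding S_def by (rule mem_set_of, rule is_set_sep) (intro definable_intros)
  then have S: "t \<^bold>\<in> S \<longleftrightarrow> (\<exists>F. F \<^bold>\<subseteq> Y \<and> Finite F \<and> \<not> is_empty F \<and> is_sum G F t)" for t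
    using is_sum_mem by blast
  have zero: "is_sum G emp t \<longleftrightarrow> t = emp" for t
  proof
    assume "is_sum G emp t"
    then obtain n where n: "n \<^bold>\<in> omega" "sum_along G n emp t" unfolding is_sum_iff by blast
    then have "has_size n emp" unfolding sum_along_def has_size_def by blast
    then have "n = emp" using card_of_eq[OF n(1)] card_of_emp by metis
    then show "t = emp" using n(2) sum_along_emp[OF G(1)] by simp
  next
    assume "t = emp"
    then show "is_sum G emp t"
      unfolding is_sum_iff using sum_along_emp[OF G(1)] emp_omega by blast
  qed
  have V: "t \<^bold>\<in> ins emp S \<longleftrightarrow> (\<exists>F. F \<^bold>\<subseteq> Y \<and> is_sum G F t)" for t
  proof
    assume "t \<^bold>\<in> ins emp S"
    then show "\<exists>F. F \<^bold>\<subseteq> Y \<and> is_sum G F t"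
      using zero[of t] S[of t] subset_emp[of Y] by (metis mem_ins)
  next
    assume "\<exists>F. F \<^bold>\<subseteq> Y \<and> is_sum G F t"
    then obtain F where F: "F \<^bold>\<subseteq> Y" "is_sum G F t" by blast
    show "t \<^bold>\<in> ins emp S"
    proof (cases "F = emp")
      case True
      then show ?thesis using F zero by simp
    next
      case False
      then have "t \<^bold>\<in> S" using F S is_sum_Finite is_empty_iff by blast
      then show ?thesis by simp
    qed
  qed
  show ?thesis
  proof (rule that)
    show "is_FS G Y S" unfolding is_FS_def using S by blast
    show "S \<^bold>\<subseteq> G" unfolding subset_def using S is_sum_mem by blast
    show "symdiff x y \<^bold>\<in> ins emp S" if "x \<^bold>\<in> ins emp S" "y \<^bold>\<in> ins emp S" for x y
      using that is_sum_symdiff[OF G Y] unfolding V by blast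
    show "Y \<^bold>\<subseteq> S"
      unfolding subset_def
    proof (intro allI impI)
      fix y assume y: "y \<^bold>\<in> Y"
      have F: "ins y emp \<^bold>\<subseteq> Y" using y unfolding subset_def by simp
      then have FG: "ins y emp \<^bold>\<subseteq> G" using Y unfolding subset_def by blast
      have "del (ins y emp) y = emp" by (rule eqI) auto
      then have "sum_along G emp (del (ins y emp) y) (symdiff y y)"
        using sum_along_emp[OF G(1)] symdiff_self by simp
      moreover have "y \<^bold>\<in> ins y emp" by simp
      ultimately have "sum_along G (succ emp) (ins y emp) y"
        using sum_along_succ[OF G(2) FG emp_omega] by blast
      then have "is_sum G (ins y emp) y" unfolding is_sum_iff using succ_omega[OF emp_omega] by blast
      then show "y \<^bold>\<in> S" using S F is_sum_Finite is_empty_iff ins_not_emp by blast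
    qed
  qed
qed

section \<open>The colouring\<close>

text \<open>
  Choosing \<open>grow n\<close> as the least suitable number replaces doubling. It makes monotonicity immediate
  and avoids arithmetic in the model.
\<close>

definition absorbs :: "'a \<Rightarrow> 'a \<Rightarrow> bool" where
  "absorbs n m \<longleftrightarrow> m \<^bold>\<in> omega \<and> n \<^bold>\<in> m \<and> (\<forall>x y. size_le n x \<longrightarrow> size_le n y \<longrightarrow> size_le m (cup x y))"

definition grow :: "'a \<Rightarrow> 'a" where
  "grow n = description (\<lambda>m. absorbs n m \<and> (\<forall>k. k \<^bold>\<in> omega \<longrightarrow> absorbs n k \<longrightarrow> le m k))"

lemma definable_absorbs: "definable_term s \<Longrightarrow> definable_term t \<Longrightarrow> definable (\<lambda>e. absorbs (s e) (t e))"
  by (rule definable_comp2) (unfold absorbs_def, intro definable_intros)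
lemmas [definable_intros] = definable_absorbs
lemma definable_term_grow: "definable_term s \<Longrightarrow> definable_term (\<lambda>e. grow (s e))"
  by (rule definable_term_comp1) (unfold grow_def, intro definable_intros)
lemmas [definable_intros] = definable_term_grow

lemma le_antisym: "n \<^bold>\<in> omega \<Longrightarrow> le m n \<Longrightarrow> le n m \<Longrightarrow> m = n"
  unfolding le_def using less_trans less_irrefl by blast

lemma
  assumes n: "n \<^bold>\<in> omega"
  shows absorbs_grow: "absorbs n (grow n)"
    and grow_le: "absorbs n k \<Longrightarrow> le (grow n) k"
proof -
  obtain m where m: "m \<^bold>\<in> omega" "\<And>x y. size_le n x \<Longrightarrow> size_le n y \<Longrightarrow> size_le m (cup x y)"
    using size_le_cup[OF n] by metis
  \<comment> \<open>The union bound alone does not give \<open>n < m\<close>: for \<open>n = 0\<close> it is satisfied by \<open>m = 0\<close>.\<close>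
  define m' where "m' = (if le m n then succ n else m)"
  have "m' \<^bold>\<in> omega" "n \<^bold>\<in> m'" "le m m'"
    using m(1) n not_le[of m n] by (auto simp: m'_def le_def)
  then have "absorbs n m'" unfolding absorbs_def using size_le_mono m(2) by blast
  have definable: "definable (\<lambda>e. absorbs n (e 0))" by (intro definable_intros)
  obtain l where l: "l \<^bold>\<in> omega" "absorbs n l" "\<And>k. k \<^bold>\<in> l \<Longrightarrow> \<not> absorbs n k"
    using omega_minimal[of "absorbs n", OF definable \<open>m' \<^bold>\<in> omega\<close> \<open>absorbs n m'\<close>] by blast
  have least: "le l k" if "k \<^bold>\<in> omega" "absorbs n k" for k
    using not_le[OF l(1) that(1)] l(3) that(2) by blast
  have "grow n = l"
    unfolding grow_def
  proof (rule description_eq)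
    show "absorbs n l \<and> (\<forall>k. k \<^bold>\<in> omega \<longrightarrow> absorbs n k \<longrightarrow> le l k)" using l(2) least by blast
    fix m assume m: "absorbs n m \<and> (\<forall>k. k \<^bold>\<in> omega \<longrightarrow> absorbs n k \<longrightarrow> le m k)"
    then have "m \<^bold>\<in> omega" unfolding absorbs_def by blast
    then show "m = l" using m l(1,2) least le_antisym by blast
  qed
  then show "absorbs n (grow n)" "absorbs n k \<Longrightarrow> le (grow n) k"
    using l least unfolding absorbs_def by auto
qed

lemma grow_omega [simp]: "n \<^bold>\<in> omega \<Longrightarrow> grow n \<^bold>\<in> omega" and less_grow: "n \<^bold>\<in> omega \<Longrightarrow> n \<^bold>\<in> grow n"
  and size_le_grow: "n \<^bold>\<in> omega \<Longrightarrow> size_le n x \<Longrightarrow> size_le n y \<Longrightarrow> size_le (grow n) (cup x y)"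
  using absorbs_grow unfolding absorbs_def by blast+

lemma grow_mono:
  assumes "n \<^bold>\<in> omega" "le k n"
  shows "le (grow k) (grow n)"
proof (rule grow_le)
  show "k \<^bold>\<in> omega" using le_omega assms by blast
  show "absorbs k (grow n)"
    using absorbs_grow[OF assms(1)] assms size_le_mono le_less_trans unfolding absorbs_def by blast
qed

text \<open>
  \<open>Q = {0, g 0, g (g 0), \<dots>}\<close> for \<open>g = grow \<circ> grow\<close>, given as a least closed set instead of by a
  recursion on \<open>\<omega>\<close>.
\<close>

definition Q :: 'a where
  "Q = set_of (\<lambda>n. n \<^bold>\<in> omega \<and> (\<forall>v. emp \<^bold>\<in> v \<and> (\<forall>k. k \<^bold>\<in> v \<longrightarrow> grow (grow k) \<^bold>\<in> v) \<longrightarrow> n \<^bold>\<in> v))"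

lemma mem_Q: "n \<^bold>\<in> Q \<longleftrightarrow> n \<^bold>\<in> omega \<and> (\<forall>v. emp \<^bold>\<in> v \<and> (\<forall>k. k \<^bold>\<in> v \<longrightarrow> grow (grow k) \<^bold>\<in> v) \<longrightarrow> n \<^bold>\<in> v)"
  unfolding Q_def by (rule mem_set_of, rule is_set_sep) (intro definable_intros)

lemma Q_omega: "q \<^bold>\<in> Q \<Longrightarrow> q \<^bold>\<in> omega" and Q_emp: "emp \<^bold>\<in> Q" and Q_grow: "q \<^bold>\<in> Q \<Longrightarrow> grow (grow q) \<^bold>\<in> Q"
  unfolding mem_Q by auto

lemma Q_induct:
  assumes "q \<^bold>\<in> Q" "definable (\<lambda>e. P (e 0))" "P emp" "\<And>q. q \<^bold>\<in> Q \<Longrightarrow> P q \<Longrightarrow> P (grow (grow q))"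
  shows "P q"
proof -
  define v where "v = set_of (\<lambda>n. n \<^bold>\<in> Q \<and> P n)"
  have v: "n \<^bold>\<in> v \<longleftrightarrow> n \<^bold>\<in> Q \<and> P n" for n
    unfolding v_def by (rule mem_set_of, rule is_set_sep) (rule assms(2))
  have "emp \<^bold>\<in> v" using v Q_emp assms(3) by simp
  moreover have "\<forall>k. k \<^bold>\<in> v \<longrightarrow> grow (grow k) \<^bold>\<in> v" using v Q_grow assms(4) by simp
  ultimately have "q \<^bold>\<in> v" using assms(1) mem_Q by blast
  then show ?thesis using v by blast
qed

text \<open>
  Elements of \<open>Q\<close> other than \<open>0\<close> have the form \<open>grow (grow r)\<close> with \<open>r \<in> Q\<close>. So the step from \<open>q\<close> to
  \<open>grow (grow q)\<close> applies \<open>grow \<circ> grow\<close>, which is monotone, to the induction hypothesis for \<open>r\<close>.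
\<close>

lemma Q_separated:
  assumes "p \<^bold>\<in> Q" "q \<^bold>\<in> Q"
  shows "le p q \<or> le (grow (grow q)) p"
proof -
  have "\<forall>p. p \<^bold>\<in> Q \<longrightarrow> le p q \<or> le (grow (grow q)) p"
    using assms(2)
  proof (rule Q_induct)
    show "definable (\<lambda>e. \<forall>p. p \<^bold>\<in> Q \<longrightarrow> le p (e 0) \<or> le (grow (grow (e 0))) p)" by (intro definable_intros)
    have "p = emp \<or> (\<exists>r. r \<^bold>\<in> Q \<and> p = grow (grow r))" if "p \<^bold>\<in> Q" for p
      using that by (rule Q_induct) (intro definable_intros | blast)+
    note cases = this
    show "\<forall>p. p \<^bold>\<in> Q \<longrightarrow> le p emp \<or> le (grow (grow emp)) p"
    proof (intro allI impI)
      fix p assume "p \<^bold>\<in> Q"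
      then consider "p = emp" | r where "r \<^bold>\<in> Q" "p = grow (grow r)" using cases by blast
      then show "le p emp \<or> le (grow (grow emp)) p"
        by cases (simp_all add: grow_mono emp_le Q_omega)
    qed
    fix s assume s: "s \<^bold>\<in> Q" and IH: "\<forall>p. p \<^bold>\<in> Q \<longrightarrow> le p s \<or> le (grow (grow s)) p"
    show "\<forall>p. p \<^bold>\<in> Q \<longrightarrow> le p (grow (grow s)) \<or> le (grow (grow (grow (grow s)))) p"
    proof (intro allI impI)
      fix p assume "p \<^bold>\<in> Q"
      then consider "p = emp" | r where "r \<^bold>\<in> Q" "p = grow (grow r)" using cases by blast
      then show "le p (grow (grow s)) \<or> le (grow (grow (grow (grow s)))) p"
      proof cases
        case 1
        then show ?thesis by (simp add: emp_le s Q_omega)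
      next
        case 2
        then have "le r s \<or> le (grow (grow s)) r" using IH by blast
        then show ?thesis using 2 s by (auto simp: grow_mono Q_omega)
      qed
    qed
  qed
  then show ?thesis using assms(1) by blast
qed

lemma Q_unbounded:
  assumes "n \<^bold>\<in> omega"
  shows "\<exists>q. q \<^bold>\<in> Q \<and> le n q"
  using assms
proof (induction n rule: omega_induct)
  case definable
  show ?case by (intro definable_intros)
next
  case emp
  show ?case using Q_emp by (intro exI[of _ emp]) simp
next
  case (succ n)
  then obtain q where q: "q \<^bold>\<in> Q" "le n q" by blast
  have omega: "q \<^bold>\<in> omega" "grow q \<^bold>\<in> omega" "grow (grow q) \<^bold>\<in> omega" using Q_omega[OF q(1)] by simp_all
  have "q \<^bold>\<in> grow (grow q)"
    using less_trans[OF omega(3) less_grow[OF omega(2)] less_grow[OF omega(1)]] .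
  with q(2) have "n \<^bold>\<in> grow (grow q)" by (rule le_less_trans[OF omega(3)])
  then have "le (succ n) (grow (grow q))" using succ_le[OF succ(1) omega(3)] by blast
  then show ?case using Q_grow q(1) by blast
qed

definition marked :: "'a \<Rightarrow> bool" where
  "marked n \<longleftrightarrow> (\<exists>q. q \<^bold>\<in> Q \<and> q \<^bold>\<in> n \<and> le n (grow q))"

lemma definable_marked: "definable_term s \<Longrightarrow> definable (\<lambda>e. marked (s e))"
  by (rule definable_comp1) (unfold marked_def, intro definable_intros)
lemmas [definable_intros] = definable_marked

text \<open>
  By \<open>Q_separated\<close>, a marked interval \<open>(p, grow p]\<close> ends by \<open>grow q\<close> or begins at \<open>grow (grow q)\<close> or
  later.
\<close>

lemma not_marked:
  assumes q: "q \<^bold>\<in> Q" and n: "grow q \<^bold>\<in> n" "le n (grow (grow q))"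
  shows "\<not> marked n"
proof
  assume "marked n"
  then obtain p where p: "p \<^bold>\<in> Q" "p \<^bold>\<in> n" "le n (grow p)" unfolding marked_def by blast
  have omega: "n \<^bold>\<in> omega" "p \<^bold>\<in> omega" "q \<^bold>\<in> omega"
    using le_omega[OF _ n(2)] Q_omega p(1) q by simp_all
  from Q_separated[OF p(1) q] show False
  proof
    assume "le p q"
    then have "le (grow p) (grow q)" using grow_mono omega by blast
    then have "le n (grow q)" using p(3) le_trans omega grow_omega by blast
    then show False using n(1) not_le[of n "grow q"] omega by simp
  next
    assume "le (grow (grow q)) p"
    then have "le n p" using n(2) le_trans omega by blast
    then show False using p(2) not_le[of n p] omega by simp
  qed
qed

section \<open>Groups of finite subsets of a C-finite set\<close>

lemma Finite_omega: "n \<^bold>\<in> omega \<Longrightarrow> Finite n"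
proof -
  assume "n \<^bold>\<in> omega"
  moreover have "bij (\<lambda>z. z) n n" by (intro bijI) auto
  moreover have "definable_fun (\<lambda>z. z)" by (rule definable_term_var)
  ultimately show ?thesis unfolding Finite_iff has_size_iff
      by (intro exI[of _ n] conjI exI[of _ "\<lambda>z. z"])
qed

text \<open>
  Let \<open>A\<close> be the range of \<open>f\<close>. If \<open>A\<close> were unbounded, each \<open>n\<close> would be the number of elements of \<open>A\<close>
  below some \<open>a \<in> A\<close>, and \<open>x \<mapsto> |A \<inter> f x|\<close> would map \<open>X\<close> onto \<open>\<omega>\<close>.
\<close>

lemma C_finite_bounded:
  assumes X: "C_finite X" and f: "definable_fun f" "\<And>x. x \<^bold>\<in> X \<Longrightarrow> f x \<^bold>\<in> omega"
  shows "\<exists>n. n \<^bold>\<in> omega \<and> (\<forall>x. x \<^bold>\<in> X \<longrightarrow> le (f x) n)"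
proof (rule ccontr)
  assume contr: "\<not> ?thesis"
  have unb: "\<exists>x. x \<^bold>\<in> X \<and> n \<^bold>\<in> f x" if n: "n \<^bold>\<in> omega" for n
  proof -
    obtain x where "x \<^bold>\<in> X" "\<not> le (f x) n" using contr n by blast
    then show ?thesis using not_le[OF f(2) n] by blast
  qed
  define A where "A = img f X"
  have A: "a \<^bold>\<in> A \<longleftrightarrow> (\<exists>x. x \<^bold>\<in> X \<and> a = f x)" for a
    unfolding A_def by (rule mem_img[OF f(1)])
  have definable_A: "definable (\<lambda>e. e 0 \<^bold>\<in> A)" by (intro definable_intros)
  have Aom: "a \<^bold>\<in> omega" if a: "a \<^bold>\<in> A" for a
  proof -
    obtain x where "x \<^bold>\<in> X" "a = f x" using a unfolding A by blast
    then show ?thesis using f(2) by simp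
  qed
  have fin: "Finite (cap A a)" if "a \<^bold>\<in> omega" for a
    using Finite_subset[OF Finite_omega[OF that]] by (simp add: subset_def)
  have rank: "\<exists>a. a \<^bold>\<in> A \<and> card_of (cap A a) = n" if "n \<^bold>\<in> omega" for n
    using that
  proof (induction n rule: omega_induct)
    case definable
    show ?case by (intro definable_intros)
  next
    case emp
    obtain b where "b \<^bold>\<in> A" using unb[OF emp_omega] A by blast
    from omega_minimal[of "\<lambda>a. a \<^bold>\<in> A", OF definable_A Aom[OF this] this]
    obtain a where a: "a \<^bold>\<in> A" "\<And>k. k \<^bold>\<in> a \<Longrightarrow> \<not> k \<^bold>\<in> A" by blast
    have "cap A a = emp" by (rule eqI) (use a in auto)
    then show ?case using a(1) by (intro exI[of _ a]) simp
  next
    case (succ n)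
    then obtain a where a: "a \<^bold>\<in> A" "card_of (cap A a) = n" by blast
    obtain b where b: "b \<^bold>\<in> A" "a \<^bold>\<in> b" using unb[OF Aom[OF a(1)]] A by blast
    have "definable (\<lambda>e. e 0 \<^bold>\<in> A \<and> a \<^bold>\<in> e 0)" by (intro definable_intros)
    \<comment> \<open>The successor of \<open>a\<close> in \<open>A\<close> has exactly one more predecessor, namely \<open>a\<close> itself.\<close>
    from omega_minimal[of "\<lambda>c. c \<^bold>\<in> A \<and> a \<^bold>\<in> c", OF this Aom[OF b(1)]] b
    obtain c where c: "c \<^bold>\<in> omega" "c \<^bold>\<in> A" "a \<^bold>\<in> c" "\<And>k. k \<^bold>\<in> c \<Longrightarrow> \<not> (k \<^bold>\<in> A \<and> a \<^bold>\<in> k)" by blast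
    have "cap A c = ins a (cap A a)"
    proof (rule eqI)
      fix k
      show "k \<^bold>\<in> cap A c \<longleftrightarrow> k \<^bold>\<in> ins a (cap A a)"
        using c a(1) Aom less_linear[of k a] less_trans[OF c(1,3), of k] by auto
    qed
    moreover have "\<not> a \<^bold>\<in> cap A a" using less_irrefl by simp
    ultimately have "card_of (cap A c) = succ n"
      using Finite_ins_new[OF fin[OF Aom[OF a(1)]]] a(2) by simp
    then show ?case using c(2) by blast
  qed
  define g where "g = (\<lambda>x. card_of (cap A (f x)))"
  have g: "definable_fun g" unfolding g_def by (intro definable_intros f(1))
  have "is_function (graph g X) X omega"
    by (rule is_function_graph[OF g]) (simp add: g_def card_of_omega fin f(2))
  moreover have "\<exists>x. x \<^bold>\<in> X \<and> maps_to (graph g X) x n" if n: "n \<^bold>\<in> omega" for n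
  proof -
    obtain a where "a \<^bold>\<in> A" "card_of (cap A a) = n" using rank[OF n] by blast
    then obtain x where "x \<^bold>\<in> X" "g x = n" unfolding A g_def by blast
    then show ?thesis using maps_to_graph[OF g] by blast
  qed
  ultimately have "is_surjection (graph g X) X omega" unfolding is_surjection_def by blast
  then show False using X is_omega_omega unfolding C_finite_def by blast
qed

text \<open>
  The combinatorial core. Boundedness of \<open>f\<close> provides \<open>N\<close>, a gap above \<open>N\<close> provides the subgroup
  \<open>W\<close>, and an element \<open>v\<close> of largest size in \<open>W\<close> bounds \<open>W\<close> by the power set of \<open>v\<close>. Since every
  point of \<open>\<Union>V\<close> lies in a member of \<open>W\<close>, the power set of \<open>\<Union>W\<close> bounds \<open>V\<close>.
\<close>

lemma gap_imp_Finite: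
  assumes X: "C_finite X"
    and V: "\<And>u. u \<^bold>\<in> V \<Longrightarrow> u \<^bold>\<subseteq> X \<and> Finite u" "emp \<^bold>\<in> V" "\<And>u v. u \<^bold>\<in> V \<Longrightarrow> v \<^bold>\<in> V \<Longrightarrow> symdiff u v \<^bold>\<in> V"
    and gaps: "\<And>n. n \<^bold>\<in> omega \<Longrightarrow> \<exists>p. p \<^bold>\<in> omega \<and> le n p \<and>
      (\<forall>u. u \<^bold>\<in> V \<longrightarrow> \<not> (p \<^bold>\<in> card_of u \<and> le (card_of u) (grow p)))"
  shows "Finite V"
proof -
  \<comment> \<open>the least size of an element of \<open>V\<close> containing \<open>x\<close>\<close>
  define f where "f = (\<lambda>x. description (\<lambda>n. n \<^bold>\<in> omega \<and> (\<exists>u. u \<^bold>\<in> V \<and> x \<^bold>\<in> u \<and> size_le n u) \<and>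
    (\<forall>m. m \<^bold>\<in> n \<longrightarrow> \<not> (\<exists>u. u \<^bold>\<in> V \<and> x \<^bold>\<in> u \<and> size_le m u))))"
  have f: "f x \<^bold>\<in> omega \<and> (\<exists>u. u \<^bold>\<in> V \<and> x \<^bold>\<in> u \<and> size_le (f x) u)" if x: "x \<^bold>\<in> bigcup V" for x
  proof -
    define P where "P = (\<lambda>n. \<exists>u. u \<^bold>\<in> V \<and> x \<^bold>\<in> u \<and> size_le n u)"
    have definable: "definable (\<lambda>e. P (e 0))" unfolding P_def by (intro definable_intros)
    obtain u where u: "u \<^bold>\<in> V" "x \<^bold>\<in> u" using x by auto
    then have "card_of u \<^bold>\<in> omega" "P (card_of u)" unfolding P_def size_le_def
        using V(1) card_of_omega le_refl by blast+
    from omega_minimal[OF definable this]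
    obtain n where n: "n \<^bold>\<in> omega" "P n" "\<And>m. m \<^bold>\<in> n \<Longrightarrow> \<not> P m" by blast
    have "f x = description (\<lambda>n. n \<^bold>\<in> omega \<and> P n \<and> (\<forall>m. m \<^bold>\<in> n \<longrightarrow> \<not> P m))"
      unfolding f_def P_def ..
    also have "\<dots> = n"
    proof (rule description_eq)
      show "n \<^bold>\<in> omega \<and> P n \<and> (\<forall>m. m \<^bold>\<in> n \<longrightarrow> \<not> P m)" using n by blast
      show "m = n" if "m \<^bold>\<in> omega \<and> P m \<and> (\<forall>k. k \<^bold>\<in> m \<longrightarrow> \<not> P k)" for m
        using that n less_linear[of m n] by blast
    qed
    finally show ?thesis using n(1,2) unfolding P_def by simp
  qed
  define h where "h = (\<lambda>x. if x \<^bold>\<in> bigcup V then f x else emp)"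
  have "definable_fun h" unfolding h_def f_def by (intro definable_intros)
  moreover have "h x \<^bold>\<in> omega" for x unfolding h_def using f by simp
  ultimately obtain N where N: "N \<^bold>\<in> omega" "\<And>x. x \<^bold>\<in> X \<Longrightarrow> le (h x) N"
    using C_finite_bounded[OF X] by blast
  obtain p where p: "p \<^bold>\<in> omega" "le N p" "\<And>u. u \<^bold>\<in> V \<Longrightarrow> \<not> (p \<^bold>\<in> card_of u \<and> le (card_of u) (grow p))"
    using gaps[OF N(1)] by blast
  define W where "W = set_of (\<lambda>u. u \<^bold>\<in> V \<and> size_le p u)"
  have W: "u \<^bold>\<in> W \<longleftrightarrow> u \<^bold>\<in> V \<and> size_le p u" for u
    unfolding W_def by (rule mem_set_of, rule is_set_sep) (intro definable_intros)
  \<comment> \<open>The gap above \<open>p\<close> makes \<open>W\<close> closed under sums.\<close>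
  have W_symdiff: "symdiff u v \<^bold>\<in> W" if "u \<^bold>\<in> W" "v \<^bold>\<in> W" for u v
  proof -
    have V_symdiff: "symdiff u v \<^bold>\<in> V" using that V(3) W by blast
    have "size_le (grow p) (cup u v)" using that W size_le_grow p(1) by blast
    moreover have "symdiff u v \<^bold>\<subseteq> cup u v" by (auto simp: subset_def)
    ultimately have "size_le (grow p) (symdiff u v)" using size_le_subset p(1) by simp
    then have "Finite (symdiff u v)" "\<not> p \<^bold>\<in> card_of (symdiff u v)"
        using p(3)[OF V_symdiff] unfolding size_le_def by auto
    then have "size_le p (symdiff u v)" unfolding size_le_def
        using not_le[OF card_of_omega p(1)] by blast
    then show ?thesis using V_symdiff W by blast
  qed
  have W_emp: "emp \<^bold>\<in> W" using V(2) W p(1) by (simp add: size_le_def emp_le)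
  \<comment> \<open>The least upper bound \<open>m\<close> of the sizes in \<open>W\<close> is attained, by some \<open>v\<close>.\<close>
  have "definable (\<lambda>e. \<forall>u. u \<^bold>\<in> W \<longrightarrow> size_le (e 0) u)" by (intro definable_intros)
  from omega_minimal[of "\<lambda>m. \<forall>u. u \<^bold>\<in> W \<longrightarrow> size_le m u", OF this p(1)] W
  obtain m where m: "m \<^bold>\<in> omega" "\<And>u. u \<^bold>\<in> W \<Longrightarrow> size_le m u" "\<And>k. k \<^bold>\<in> m \<Longrightarrow> \<not> (\<forall>u. u \<^bold>\<in> W \<longrightarrow> size_le k u)"
    by blast
  have "\<exists>v. v \<^bold>\<in> W \<and> card_of v = m"
    using m(1)
  proof (cases m rule: omega_cases)
    case 1
    then show ?thesis using W_emp by (intro exI[of _ emp]) simp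
  next
    case (2 k)
    then obtain v where v: "v \<^bold>\<in> W" "\<not> size_le k v" using m(3)[of k] by auto
    then have "Finite v" "le (card_of v) m" using m(2) unfolding size_le_def by blast+
    moreover from this have "k \<^bold>\<in> card_of v"
        using v(2) not_le[OF card_of_omega 2(1)] unfolding size_le_def by blast
    ultimately have "card_of v = m"
      using le_antisym[OF m(1)] succ_le[OF 2(1) card_of_omega] 2(2) by blast
    then show ?thesis using v(1) by blast
  qed
  then obtain v where v: "v \<^bold>\<in> W" "card_of v = m" by blast
  have disjoint: "u = emp" if u: "u \<^bold>\<in> W" "\<And>z. z \<^bold>\<in> u \<Longrightarrow> \<not> z \<^bold>\<in> v" for u
  proof (rule ccontr)
    assume "u \<noteq> emp"
    then obtain a where a: "a \<^bold>\<in> u" using nonempty by blast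
    have "size_le m (symdiff v u)" using m(2) W_symdiff v(1) u(1) by blast
    moreover have "v \<^bold>\<subseteq> symdiff v u" using u(2) by (auto simp: subset_def)
    moreover have "a \<^bold>\<in> symdiff v u" "\<not> a \<^bold>\<in> v" using a u(2) by auto
    ultimately have "le (card_of (symdiff v u)) m" "m \<^bold>\<in> card_of (symdiff v u)"
      using psubset_card_of[of "symdiff v u" v a] v(2) unfolding size_le_def by auto
    then show False using le_less_trans less_irrefl less_trans m(1) unfolding le_def by metis
  qed
  have "Finite v" using v(1) W unfolding size_le_def by blast
  then have "Finite (powerset v)" by (rule Finite_powerset)
  moreover have "definable_fun (\<lambda>u. cap u v)" by (intro definable_intros)
  moreover have "cap u v \<^bold>\<in> powerset v" for u by (simp add: subset_def)
  moreover have "u = w" if "u \<^bold>\<in> W" "w \<^bold>\<in> W" "cap u v = cap w v" for u w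
  proof -
    have "z \<^bold>\<in> cap u v \<longleftrightarrow> z \<^bold>\<in> cap w v" for z using that(3) by simp
    then have "symdiff u w = emp" using disjoint[OF W_symdiff[OF that(1,2)]] by auto
    then have "z \<^bold>\<in> symdiff u w \<longleftrightarrow> z \<^bold>\<in> emp" for z by simp
    then show ?thesis by (intro eqI) auto
  qed
  ultimately have "Finite W" using Finite_inj[of "\<lambda>u. cap u v" "powerset v" W] by blast
  then have "Finite (bigcup W)" using Finite_bigcup W unfolding size_le_def by blast
  then have "Finite (powerset (bigcup W))" by (rule Finite_powerset)
  moreover have "V \<^bold>\<subseteq> powerset (bigcup W)"
    unfolding subset_def mem_powerset
  proof (intro allI impI)
    fix u x assume u: "u \<^bold>\<in> V" and x: "x \<^bold>\<in> u"
    then have xV: "x \<^bold>\<in> bigcup V" and xX: "x \<^bold>\<in> X" using V(1) unfolding subset_def by auto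
    then obtain w where w: "w \<^bold>\<in> V" "x \<^bold>\<in> w" "size_le (f x) w" using f by blast
    have "le (f x) N" using N(2)[OF xX] xV unfolding h_def by simp
    then have "size_le p w" using w(3) size_le_mono p(1,2) le_trans by blast
    then show "x \<^bold>\<in> bigcup W" using w W by auto
  qed
  ultimately show ?thesis using Finite_subset by blast
qed

theorem C_finite_imp_H_finite:
  assumes X: "C_finite X"
  shows "H_finite X"
proof -
  define G where "G = set_of (\<lambda>s. s \<^bold>\<in> powerset X \<and> Finite s)"
  have G: "s \<^bold>\<in> G \<longleftrightarrow> s \<^bold>\<subseteq> X \<and> Finite s" for s
  proof -
    have "s \<^bold>\<in> G \<longleftrightarrow> s \<^bold>\<in> powerset X \<and> Finite s"
      unfolding G_def by (rule mem_set_of, rule is_set_sep) (intro definable_intros)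
    then show ?thesis by simp
  qed
  have G_emp: "emp \<^bold>\<in> G" by (simp add: G)
  have G_symdiff: "symdiff x y \<^bold>\<in> G" if "x \<^bold>\<in> G" "y \<^bold>\<in> G" for x y
  proof -
    have "symdiff x y \<^bold>\<subseteq> cup x y" by (auto simp: subset_def)
    then have "Finite (symdiff x y)" using that G Finite_cup Finite_subset by blast
    moreover have "symdiff x y \<^bold>\<subseteq> X" using that G unfolding subset_def by auto
    ultimately show ?thesis using G by blast
  qed
  define c where "c = (\<lambda>u. if marked (card_of u) then succ emp else emp)"
  have c: "definable_fun c" unfolding c_def by (intro definable_intros)
  have two: "is_two (succ (succ emp))"
    unfolding is_two_def is_empty_iff is_succ_iff by blast
  have fn: "is_function (graph c G) G (succ (succ emp))"
    by (rule is_function_graph[OF c]) (simp add: c_def)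
  have "\<exists>S. is_FS G Y S \<and> \<not> constant_on (graph c G) S" if Y: "Y \<^bold>\<subseteq> G" "\<not> Finite Y" for Y
  proof -
    obtain S where S: "is_FS G Y S" "S \<^bold>\<subseteq> G" "Y \<^bold>\<subseteq> S"
      and span: "\<And>x y. x \<^bold>\<in> ins emp S \<Longrightarrow> y \<^bold>\<in> ins emp S \<Longrightarrow> symdiff x y \<^bold>\<in> ins emp S"
      using FS_span[OF G_emp G_symdiff Y(1)] by blast
    have "\<not> constant_on (graph c G) S"
    proof
      assume "constant_on (graph c G) S"
      then obtain i where i: "\<And>t. t \<^bold>\<in> S \<Longrightarrow> c t = i"
        unfolding constant_on_def maps_to_graph[OF c] by blast
      have card_of: "u \<^bold>\<in> S" if "u \<^bold>\<in> ins emp S" "p \<^bold>\<in> card_of u" for u p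
        using that by auto
      have "Finite (ins emp S)"
      proof (rule gap_imp_Finite[OF X])
        show "u \<^bold>\<subseteq> X \<and> Finite u" if "u \<^bold>\<in> ins emp S" for u
          using that S(2) G unfolding subset_def by auto
        show "emp \<^bold>\<in> ins emp S" by simp
        show "symdiff u v \<^bold>\<in> ins emp S" if "u \<^bold>\<in> ins emp S" "v \<^bold>\<in> ins emp S" for u v
          using that by (rule span)
        fix n assume n: "n \<^bold>\<in> omega"
        then obtain q where q: "q \<^bold>\<in> Q" "le n q" using Q_unbounded by blast
        have qom: "q \<^bold>\<in> omega" using q Q_omega by blast
        \<comment> \<open>If all sizes are marked, the gaps start at \<open>grow q\<close>; if none is, they start at \<open>q\<close>.\<close>
        show "\<exists>p. p \<^bold>\<in> omega \<and> le n p \<and> (\<forall>u. u \<^bold>\<in> ins emp S \<longrightarrow> \<not> (p \<^bold>\<in> card_of u \<and>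
            le (card_of u) (grow p)))"
        proof (cases "i = succ emp")
          case True
          then have marked: "marked (card_of u)" if "u \<^bold>\<in> S" for u
            using i[OF that] unfolding c_def by (metis succ_not_emp)
          have "le n (grow q)" using q(2) le_trans less_imp_le less_grow qom by (metis grow_omega)
          then show ?thesis
            using qom card_of marked not_marked[OF q(1)] by (intro exI[of _ "grow q"]) auto
        next
          case False
          then have "\<not> marked (card_of u)" if "u \<^bold>\<in> S" for u
            using i[OF that] unfolding c_def by auto
          then show ?thesis
            using qom q card_of unfolding marked_def by (intro exI[of _ q]) blast
        qed
      qed
      moreover have "Y \<^bold>\<subseteq> ins emp S" using S(3) unfolding subset_def by simp
      ultimately show False using Y(2) Finite_subset by blast
    qed
    then show ?thesis using S(1) by blast
  qed
  moreover have "is_finite_subsets X G" unfolding is_finite_subsets_def using G by blast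
  ultimately show ?thesis unfolding H_finite_def using two fn by blast
qed

end

theorem theorem3p7:
  fixes mem :: "'a \<Rightarrow> 'a \<Rightarrow> bool"
  assumes "ZF_model mem"
  shows "\<forall>X. set_structure.C_finite mem X \<longrightarrow> set_structure.H_finite mem X"
  using ZF_model.C_finite_imp_H_finite[OF assms] by blast

end
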